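(* There are absolute constants $c_0>0$ and $C>0$ such that the following holds. Let $\epsilon,\epsilon'>0$, let $0<\delta<1$ with $\delta\ge\epsilon'/8$, let $d\ge 2$ be an integer, and let $S$ satisfy \[ S\le \exp\left( c_0\left(\frac{\sqrt{\epsilon'}}{\epsilon}\cdot\frac{\sqrt{\log(1/\delta)}}{\log(1/\epsilon')}\right)^{1/(d-1)}\right). \] Then for some $n\le C\log(1/\delta)/\epsilon^2$ there is a random variable $\mathbf D$ over $\{0,1\}^n$ such that, with respect to the test class $\mathcal C(S,d)$ (on $n$ inputs), $\mathbf D$ is $\delta$-dense in some $\epsilon'$-pseudorandom random variable, but $\mathbf D$ does not have a $\delta$-dense $\epsilon$-model.
   Context: $\mathcal C(S,d)$ is the class of Boolean functions $\{0,1\}^n\to\{0,1\}$ computed by circuits of size at most $S$ and depth at most $d$ with unbounded fan-in AND and OR gates and NOT gates. $\mathbf U$ is uniform on $\{0,1\}^n$. For a class $\mathcal F$ of functions $\{0,1\}^n\to\{0,1\}$: $\mathbf X$ is $\epsilon$-pseudorandom for $\mathcal F$ if $|\mathbb E f(\mathbf X)-\mathbb E f(\mathbf U)|\le\epsilon$ for all $f\in\mathcal F$; $\mathbf Z$ is $\delta$-dense in $\mathbf X$ if $\delta\Pr[\mathbf Z=z]\le\Pr[\mathbf X=z]$ for all $z$; $\mathbf Z$ is $\delta$-dense if it is $\delta$-dense in $\mathbf U$; $\mathbf Z$ has a $\delta$-dense $\epsilon$-model if there is a $\delta$-dense $\mathbf M$ with $|\mathbb E f(\mathbf Z)-\mathbb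 E f(\mathbf M)|\le\epsilon$ for all $f\in\mathcal F$. Logarithms are base 2.
   Formalization: Adds S ≥ 2 (S a natural number) and ε' ≤ 1/2: for S = 1, ε = 1, or for ε' close to 1 with ε = 1, the bound on S holds for every c₀ but U is a δ-dense ε-model of every D, so the claim as stated fails. *)

theory Defs
  imports "HOL-Probability.Probability"
begin

text \<open>
  Circuits are straight-line programs, so gates may be shared (arbitrary fan-out).  On \<open>n\<close> inputs,
  node \<open>i < n\<close> is the \<open>i\<close>-th input and node \<open>n + k\<close> is the \<open>k\<close>-th gate, which may only read
  nodes with a smaller number.
\<close>

datatype gate = NotG nat | AndG "nat list" | OrG "nat list"

datatype circuit = Circuit (gates: "gate list") (out_node: nat)

fun gate_args :: "gate \<Rightarrow> nat set" where
  "gate_args (NotG i) = {i}"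
| "gate_args (AndG is) = set is"
| "gate_args (OrG is) = set is"

definition wf_circuit :: "nat \<Rightarrow> circuit \<Rightarrow> bool" where
  "wf_circuit n c \<longleftrightarrow>
     (\<forall>k<length (gates c). gate_args (gates c ! k) \<subseteq> {..<n + k}) \<and>
     out_node c < n + length (gates c)"

fun gate_value :: "bool list \<Rightarrow> gate \<Rightarrow> bool" where
  "gate_value v (NotG i) \<longleftrightarrow> \<not> v ! i"
| "gate_value v (AndG is) \<longleftrightarrow> (\<forall>i\<in>set is. v ! i)"
| "gate_value v (OrG is) \<longleftrightarrow> (\<exists>i\<in>set is. v ! i)"

definition circuit_value :: "circuit \<Rightarrow> bool list \<Rightarrow> bool" where
  "circuit_value c x = foldl (\<lambda>v g. v @ [gate_value v g]) x (gates c) ! out_node c"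

text \<open>Size is the number of gates; the inputs themselves are not counted.\<close>

definition circuit_size :: "circuit \<Rightarrow> nat" where
  "circuit_size c = length (gates c)"

text \<open>
  Depth is the maximal number of AND and OR gates on a path from an input to the output; as usual
  for bounded-depth circuits, NOT gates do not contribute.
\<close>

fun gate_depth :: "nat list \<Rightarrow> gate \<Rightarrow> nat" where
  "gate_depth h (NotG i) = h ! i"
| "gate_depth h (AndG is) = Suc (Max (insert 0 ((\<lambda>i. h ! i) ` set is)))"
| "gate_depth h (OrG is) = Suc (Max (insert 0 ((\<lambda>i. h ! i) ` set is)))"

definition circuit_depth :: "nat \<Rightarrow> circuit \<Rightarrow> nat" where
  "circuit_depth n c =
     foldl (\<lambda>h g. h @ [gate_depth h g]) (replicate n 0) (gates c) ! out_node c"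

definition cube :: "nat \<Rightarrow> bool list set" where
  "cube n = {x. length x = n}"

text \<open>The class \<open>\<C>(S, d)\<close> on \<open>n\<close> inputs; values outside \<open>cube n\<close> are irrelevant.\<close>

definition circuit_class :: "nat \<Rightarrow> nat \<Rightarrow> nat \<Rightarrow> (bool list \<Rightarrow> bool) set" where
  "circuit_class n S d =
     {f. \<exists>c. wf_circuit n c \<and> circuit_size c \<le> S \<and> circuit_depth n c \<le> d \<and>
             (\<forall>x\<in>cube n. f x = circuit_value c x)}"

text \<open>A random variable over \<open>{0,1}\<^sup>n\<close> is given by its distribution.\<close>

definition over_cube :: "nat \<Rightarrow> bool list pmf \<Rightarrow> bool" where
  "over_cube n X \<longleftrightarrow> set_pmf X \<subseteq> cube n"

definition uniform :: "nat \<Rightarrow> bool list pmf" where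
  "uniform n = pmf_of_set (cube n)"

definition expect :: "(bool list \<Rightarrow> bool) \<Rightarrow> bool list pmf \<Rightarrow> real" where
  "expect f X = measure_pmf.expectation X (\<lambda>x. of_bool (f x))"

definition pseudorandom :: "nat \<Rightarrow> (bool list \<Rightarrow> bool) set \<Rightarrow> real \<Rightarrow> bool list pmf \<Rightarrow> bool" where
  "pseudorandom n F \<epsilon> X \<longleftrightarrow>
     over_cube n X \<and> (\<forall>f\<in>F. \<bar>expect f X - expect f (uniform n)\<bar> \<le> \<epsilon>)"

definition dense_in :: "real \<Rightarrow> bool list pmf \<Rightarrow> bool list pmf \<Rightarrow> bool" where
  "dense_in \<delta> Z X \<longleftrightarrow> (\<forall>z. \<delta> * pmf Z z \<le> pmf X z)"

definition has_dense_model ::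
    "nat \<Rightarrow> (bool list \<Rightarrow> bool) set \<Rightarrow> real \<Rightarrow> real \<Rightarrow> bool list pmf \<Rightarrow> bool" where
  "has_dense_model n F \<delta> \<epsilon> Z \<longleftrightarrow>
     (\<exists>M. over_cube n M \<and> dense_in \<delta> M (uniform n) \<and>
          (\<forall>f\<in>F. \<bar>expect f Z - expect f M\<bar> \<le> \<epsilon>))"

end

(* The distribution D consists of independent bits of bias g = 4 eps.  An exponential-moment
   comparison with the uniform distribution shows that a delta-dense distribution on
   n ~ log(1/delta)/eps^2 bits has average bias at most 3 eps/2, so some single coordinate already
   refutes every dense model.

   On the other side, for a circuit f of size S and depth d put B = (O(log S))^(d-1).  Then
   E f(bits of bias g) = E f(U) + b g + O((B g)^2) for |g| <= 1/B: bits of bias g are obtained by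
   filling the free positions of a random restriction with bits of bias g/p, and after d rounds of
   the switching lemma f has shallow decision trees, for which the expansion is elementary.  Rounds
   that fail cost nothing, because after the first round f is determined by S decision trees of
   small depth.  Mixing bias g with a suitable negative bias cancels the linear term, which gives
   the pseudorandom distribution in which D is dense.  If 1 - delta <= eps', D itself is
   pseudorandom. *)

theory Submission
  imports Defs
begin

text \<open>The target error is quadratic in the bias, so the probability of a failing restriction
  may not simply be added to it: for small bias it would dominate. Every restriction must therefore
  supply its own remainder K \<theta>^2, and only the coefficients K are averaged. A decision tree
  of depth k gives K = k^2, but for a failing restriction the trivial k = n would bring in n, which
  S does not control. The fallback depth S w, available after the first round, makes the failing
  part at most S^2 w^2 times a failure probability of order S / 4^w, and w of about 4 log S absorbs
  this. In the first round the fallback depth is itself random, so a tail bound at one threshold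
  would not do; hence the switching lemma takes the form E 4^depth <= 2. The same moment yields the
  union bound over gates and the expected squared depth in the last round. After the cancellation of
  the linear term the mixture with weight r has error at most (B g)^2 / (1 - r), which is the origin
  of the square root of \<epsilon>' in the hypothesis on S.\<close>

type_synonym boolfun = "(nat \<Rightarrow> bool) \<Rightarrow> bool"

section \<open>Restrictions and averages\<close>

definition comb :: "(nat \<Rightarrow> bool option) \<Rightarrow> (nat \<Rightarrow> bool) \<Rightarrow> nat \<Rightarrow> bool" where
  "comb \<rho> x = (\<lambda>i. case \<rho> i of None \<Rightarrow> x i | Some b \<Rightarrow> b)"

definition restr :: "(nat \<Rightarrow> bool option) \<Rightarrow> boolfun \<Rightarrow> boolfun" where
  "restr \<rho> f = (\<lambda>x. f (comb \<rho> x))"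

text \<open>The variable becomes a dummy instead of being removed, so all functions keep one domain
  throughout.\<close>

definition fixv :: "boolfun \<Rightarrow> nat \<Rightarrow> bool \<Rightarrow> boolfun" where
  "fixv f v b = (\<lambda>x. f (x(v := b)))"

text \<open>A restriction maps free variables to \<open>None\<close>. \<open>rex p vs\<close> averages over the restrictions that
  keep each variable of \<open>vs\<close> free with probability \<open>p\<close>; \<open>bex \<theta> vs\<close> averages over independent bits of
  expectation \<open>\<theta>\<close> in the \<open>\<plusminus>1\<close> convention.\<close>

fun rex :: "real \<Rightarrow> nat list \<Rightarrow> ((nat \<Rightarrow> bool option) \<Rightarrow> real) \<Rightarrow> real" where
  "rex p [] \<Phi> = \<Phi> (\<lambda>_. None)"
| "rex p (v # vs) \<Phi> = p * rex p vs (\<lambda>\<rho>. \<Phi> (\<rho>(v := None)))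
     + (1 - p) / 2 * (rex p vs (\<lambda>\<rho>. \<Phi> (\<rho>(v := Some True))) + rex p vs (\<lambda>\<rho>. \<Phi> (\<rho>(v := Some False))))"

fun bex :: "real \<Rightarrow> nat list \<Rightarrow> ((nat \<Rightarrow> bool) \<Rightarrow> real) \<Rightarrow> real" where
  "bex \<theta> [] \<Phi> = \<Phi> (\<lambda>_. False)"
| "bex \<theta> (v # vs) \<Phi> = (1 + \<theta>) / 2 * bex \<theta> vs (\<lambda>x. \<Phi> (x(v := True)))
     + (1 - \<theta>) / 2 * bex \<theta> vs (\<lambda>x. \<Phi> (x(v := False)))"

lemma comb_upd_Some: "comb (\<rho>(v := Some b)) x = (comb \<rho> x)(v := b)"
  by (auto simp: comb_def fun_eq_iff)

lemma comb_upd_None: "comb (\<rho>(v := None)) (x(v := b)) = (comb \<rho> x)(v := b)"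
  by (rule ext) (simp add: comb_def split: option.split)

lemma comb_upd_upd: "(comb \<rho> (x(v := a)))(v := b) = (comb \<rho> x)(v := b)"
  by (rule ext) (simp add: comb_def split: option.split)

lemma restr_upd_Some: "restr (\<rho>(v := Some b)) f = restr \<rho> (fixv f v b)"
  by (simp add: restr_def fixv_def comb_upd_Some)

lemma fixv_restr_upd_None: "fixv (restr (\<rho>(v := None)) f) v b = restr \<rho> (fixv f v b)"
  by (simp add: restr_def fixv_def comb_upd_None)

lemma rex_add: "rex p vs (\<lambda>\<rho>. \<Phi> \<rho> + \<Psi> \<rho>) = rex p vs \<Phi> + rex p vs \<Psi>"
  by (induction vs arbitrary: \<Phi> \<Psi>) (simp_all add: algebra_simps)

lemma rex_mult: "rex p vs (\<lambda>\<rho>. c * \<Phi> \<rho>) = c * rex p vs \<Phi>"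
  by (induction vs arbitrary: \<Phi>) (simp_all add: algebra_simps)

lemma rex_const [simp]: "rex p vs (\<lambda>\<rho>. c) = c"
  by (induction vs) (simp_all add: field_simps)

lemma rex_diff: "rex p vs (\<lambda>\<rho>. \<Phi> \<rho> - \<Psi> \<rho>) = rex p vs \<Phi> - rex p vs \<Psi>"
  using rex_add[of p vs \<Phi> "\<lambda>\<rho>. - 1 * \<Psi> \<rho>"] rex_mult[of p vs "-1" \<Psi>] by simp

lemma rex_sum: "rex p vs (\<lambda>\<rho>. \<Sum>k\<in>A. \<Phi> k \<rho>) = (\<Sum>k\<in>A. rex p vs (\<Phi> k))"
  by (induction A rule: infinite_finite_induct) (simp_all add: rex_add)

lemma rex_mono:
  assumes "0 \<le> p" "p \<le> 1" "\<And>\<rho>. \<Phi> \<rho> \<le> \<Psi> \<rho>"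
  shows "rex p vs \<Phi> \<le> rex p vs \<Psi>"
  using assms(3)
  by (induction vs arbitrary: \<Phi> \<Psi>) (auto intro!: add_mono mult_left_mono simp: assms(1,2))

lemma rex_nonneg: "0 \<le> p \<Longrightarrow> p \<le> 1 \<Longrightarrow> (\<And>\<rho>. 0 \<le> \<Phi> \<rho>) \<Longrightarrow> 0 \<le> rex p vs \<Phi>"
  using rex_mono[of p "\<lambda>_. 0" \<Phi> vs] by simp

lemma rex_abs:
  assumes "0 \<le> p" "p \<le> 1"
  shows "\<bar>rex p vs \<Phi>\<bar> \<le> rex p vs (\<lambda>\<rho>. \<bar>\<Phi> \<rho>\<bar>)"
proof -
  have "rex p vs \<Phi> \<le> rex p vs (\<lambda>\<rho>. \<bar>\<Phi> \<rho>\<bar>)"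
    by (rule rex_mono[OF assms]) simp
  moreover have "rex p vs (\<lambda>\<rho>. -1 * \<Phi> \<rho>) \<le> rex p vs (\<lambda>\<rho>. \<bar>\<Phi> \<rho>\<bar>)"
    by (rule rex_mono[OF assms]) simp
  ultimately show ?thesis
    unfolding rex_mult by linarith
qed

text \<open>The averages on the right still run over all of \<open>vs\<close>; the value drawn at
  \<open>v\<close> is overwritten. Any variable can thus be exposed first without shrinking the
  list.\<close>

lemma rex_resample:
  assumes "v \<in> set vs"
  shows "rex p vs \<Phi> = p * rex p vs (\<lambda>\<rho>. \<Phi> (\<rho>(v := None)))
     + (1 - p) / 2 * (rex p vs (\<lambda>\<rho>. \<Phi> (\<rho>(v := Some True))) + rex p vs (\<lambda>\<rho>. \<Phi> (\<rho>(v := Some False))))"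
  using assms
proof (induction vs arbitrary: \<Phi>)
  case (Cons u vs)
  show ?case
  proof (cases "u = v")
    case True
    have "p * a + (1 - p) / 2 * (b + c) =
        p * (p * a + (1 - p) / 2 * (a + a)) +
        (1 - p) / 2 * ((p * b + (1 - p) / 2 * (b + b)) + (p * c + (1 - p) / 2 * (c + c)))" for a b c :: real
      by (simp add: field_simps)
    then show ?thesis
      unfolding True rex.simps fun_upd_upd .
  next
    case False
    then have v: "v \<in> set vs" using Cons.prems by simp
    have tw: "\<rho>(v := a, u := c) = \<rho>(u := c, v := a)" for \<rho> :: "nat \<Rightarrow> bool option" and a c
      using False by (simp add: fun_upd_twist)
    show ?thesis
      unfolding rex.simps
      by (subst (1 2 3) Cons.IH[OF v]) (simp add: field_simps tw)
  qed
qed simp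

lemma bex_resample:
  assumes "v \<in> set vs"
  shows "bex \<theta> vs \<Phi> = (1 + \<theta>) / 2 * bex \<theta> vs (\<lambda>x. \<Phi> (x(v := True)))
     + (1 - \<theta>) / 2 * bex \<theta> vs (\<lambda>x. \<Phi> (x(v := False)))"
  using assms
proof (induction vs arbitrary: \<Phi>)
  case (Cons u vs)
  show ?case
  proof (cases "u = v")
    case True
    have "(1 + \<theta>) / 2 * a + (1 - \<theta>) / 2 * b =
        (1 + \<theta>) / 2 * ((1 + \<theta>) / 2 * a + (1 - \<theta>) / 2 * a) +
        (1 - \<theta>) / 2 * ((1 + \<theta>) / 2 * b + (1 - \<theta>) / 2 * b)" for a b :: real
      by (simp add: field_simps)
    then show ?thesis
      unfolding True bex.simps fun_upd_upd .
  next
    case False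
    then have v: "v \<in> set vs" using Cons.prems by simp
    have tw: "x(v := a, u := c) = x(u := c, v := a)" for x :: "nat \<Rightarrow> bool" and a c
      using False by (simp add: fun_upd_twist)
    show ?thesis
      unfolding bex.simps
      by (subst (1 2) Cons.IH[OF v]) (simp add: field_simps tw)
  qed
qed simp

lemma bex_const [simp]: "bex \<theta> vs (\<lambda>x. c) = c"
  by (induction vs) (simp_all add: field_simps)

lemma bex_mono:
  assumes "\<bar>\<theta>\<bar> \<le> 1" "\<And>x. \<Phi> x \<le> \<Psi> x"
  shows "bex \<theta> vs \<Phi> \<le> bex \<theta> vs \<Psi>"
  using assms(2)
proof (induction vs arbitrary: \<Phi> \<Psi>)
  case (Cons u vs)
  show ?case
    unfolding bex.simps using assms(1) Cons.prems
    by (intro add_mono mult_left_mono Cons.IH) auto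
qed simp

text \<open>Bits of bias \<open>p\<theta>\<close> arise from a random restriction that keeps each variable free with
  probability \<open>p\<close> and gives the free variables the bias \<open>\<theta>\<close>.\<close>

lemma bex_scale:
  "bex (p * \<theta>) vs \<Phi> = rex p vs (\<lambda>\<rho>. bex \<theta> vs (\<lambda>x. \<Phi> (comb \<rho> x)))"
proof (induction vs arbitrary: \<Phi>)
  case Nil
  then show ?case by (simp add: comb_def)
next
  case (Cons v vs)
  have d: "(1 + \<theta>) / 2 * c + (1 - \<theta>) / 2 * c = c" for c :: real
    by (simp add: field_simps)
  have e: "(1 + p * \<theta>) / 2 * a + (1 - p * \<theta>) / 2 * b =
      p * ((1 + \<theta>) / 2 * a + (1 - \<theta>) / 2 * b) + (1 - p) / 2 * (a + b)" for a b :: real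
    by (simp add: field_simps)
  show ?case
    unfolding rex.simps bex.simps comb_upd_Some comb_upd_None comb_upd_upd fun_upd_upd d rex_add rex_mult
    by (simp only: Cons.IH e) (simp add: field_simps)
qed

section \<open>Decision trees\<close>

inductive dt :: "nat set \<Rightarrow> nat \<Rightarrow> boolfun \<Rightarrow> bool" for V where
  dt_const: "(\<And>x. f x = c) \<Longrightarrow> dt V k f"
| dt_query: "v \<in> V \<Longrightarrow> dt V k (fixv f v True) \<Longrightarrow> dt V k (fixv f v False) \<Longrightarrow> dt V (Suc k) f"

lemma dt_Suc: "dt V k f \<Longrightarrow> dt V (Suc k) f"
  by (induction rule: dt.induct) (auto intro: dt.intros)

lemma dt_mono: "dt V k f \<Longrightarrow> k \<le> l \<Longrightarrow> dt V l f"
  by (induction l) (auto simp: le_Suc_eq intro: dt_Suc)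

lemma fixv_same: "fixv (fixv f v a) v b = fixv f v a"
  by (simp add: fixv_def)

lemma fixv_commute: "u \<noteq> v \<Longrightarrow> fixv (fixv f u a) v b = fixv (fixv f v b) u a"
  by (simp add: fixv_def fun_upd_twist)

lemma fixv_not: "fixv (\<lambda>x. \<not> f x) v b = (\<lambda>x. \<not> fixv f v b x)"
  by (simp add: fixv_def)

lemma dt_fixv: "dt V k f \<Longrightarrow> dt V k (fixv f u b)"
proof (induction rule: dt.induct)
  case (dt_const f c k)
  then show ?case by (auto intro!: dt.dt_const[of _ c] simp: fixv_def)
next
  case (dt_query v k f)
  show ?case
  proof (cases "v = u")
    case True
    then show ?thesis using dt_query by (cases b) (auto intro: dt_Suc)
  next
    case False
    then show ?thesis using dt_query by (auto intro!: dt.dt_query[of v] simp: fixv_commute[of u v])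
  qed
qed

lemma dt_restr: "dt V k f \<Longrightarrow> dt V k (restr \<rho> f)"
proof (induction rule: dt.induct)
  case (dt_const f c k)
  then show ?case by (auto intro!: dt.dt_const[of _ c] simp: restr_def)
next
  case (dt_query v k f)
  show ?case
  proof (cases "\<rho> v")
    case None
    then have "\<rho>(v := None) = \<rho>" by auto
    then have "fixv (restr \<rho> f) v b = restr \<rho> (fixv f v b)" for b
      using fixv_restr_upd_None[of \<rho> v f b] by simp
    then show ?thesis using dt_query by (auto intro!: dt.dt_query[of v])
  next
    case (Some b)
    then have "restr \<rho> f = restr \<rho> (fixv f v b)"
      using restr_upd_Some[of \<rho> v b f] by (simp add: fun_upd_idem)
    then show ?thesis using dt_query by (cases b) (auto intro: dt_Suc)
  qed
qed

lemma dt_not: "dt V k f \<Longrightarrow> dt V k (\<lambda>x. \<not> f x)"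
proof (induction rule: dt.induct)
  case (dt_const f c k)
  then show ?case by (auto intro!: dt.dt_const[of _ "\<not> c"])
next
  case (dt_query v k f)
  then show ?case by (auto intro!: dt.dt_query[of v] simp: fixv_not)
qed

lemma dt_finite_support:
  assumes "finite W" "W \<subseteq> V" "\<And>x y. (\<forall>i\<in>W. x i = y i) \<Longrightarrow> f x = f y"
  shows "dt V (card W) f"
  using assms
proof (induction W arbitrary: f rule: finite_induct)
  case empty
  then show ?case by (auto intro: dt_const[of _ "f (\<lambda>_. False)"])
next
  case (insert v W)
  have "dt V (card W) (fixv f v b)" for b
    by (rule insert.IH) (use insert.prems in \<open>auto simp: fixv_def\<close>)
  then show ?case
    using insert by (auto intro!: dt_query[of v])
qed

text \<open>The trees are run one after another; at a leaf all the values are known, hence so is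
  \<open>f\<close>.\<close>

lemma dt_determined:
  assumes "list_all2 (\<lambda>k \<alpha>. dt V k \<alpha>) ks \<alpha>s"
    and "\<And>x y. (\<forall>\<alpha>\<in>set \<alpha>s. \<alpha> x = \<alpha> y) \<Longrightarrow> f x = f y"
  shows "dt V (sum_list ks) f"
  using assms
proof (induction ks arbitrary: \<alpha>s f)
  case Nil
  then show ?case by (auto intro: dt_const[of _ "f (\<lambda>_. False)"])
next
  case (Cons k ks)
  obtain \<alpha> \<beta>s where \<alpha>s: "\<alpha>s = \<alpha> # \<beta>s" "dt V k \<alpha>" "list_all2 (\<lambda>k \<alpha>. dt V k \<alpha>) ks \<beta>s"
    using Cons.prems(1) by (auto simp: list_all2_Cons1)
  have "\<And>x y. \<alpha> x = \<alpha> y \<Longrightarrow> \<forall>\<beta>\<in>set \<beta>s. \<beta> x = \<beta> y \<Longrightarrow> f x = f y"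
    using Cons.prems(2) \<alpha>s(1) by simp
  \<comment> \<open>Walking down the tree of \<alpha> replaces \<open>f\<close> and the remaining
    functions by their cofactors, hence the generalisation over \<open>f\<close> and
    \<open>\<beta>s\<close>.\<close>
  with \<alpha>s(2,3) have "dt V (k + sum_list ks) f"
  proof (induction arbitrary: f \<beta>s rule: dt.induct)
    case (dt_const \<alpha> c k)
    have "dt V (sum_list ks) f"
      by (rule Cons.IH[OF dt_const.prems(1)]) (use dt_const in auto)
    then show ?case by (rule dt_mono) simp
  next
    case (dt_query v k \<alpha>)
    have la: "list_all2 (\<lambda>k \<alpha>. dt V k \<alpha>) ks (map (\<lambda>\<beta>. fixv \<beta> v b) \<beta>s)" for b
      using dt_query.prems(1) by (auto simp: list_all2_conv_all_nth intro: dt_fixv)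
    have det: "fixv f v b x = fixv f v b y"
      if "fixv \<alpha> v b x = fixv \<alpha> v b y" "\<forall>\<beta>\<in>set (map (\<lambda>\<beta>. fixv \<beta> v b) \<beta>s). \<beta> x = \<beta> y" for b x y
      using that dt_query.prems(2)[of "x(v := b)" "y(v := b)"]
      by (simp add: fixv_def del: fun_upd_apply)
    have "dt V (k + sum_list ks) (fixv f v True)"
      by (rule dt_query.IH(1)[OF la[of True]]) (use det in blast)
    moreover have "dt V (k + sum_list ks) (fixv f v False)"
      by (rule dt_query.IH(2)[OF la[of False]]) (use det in blast)
    ultimately show ?case by (auto intro!: dt.dt_query[OF dt_query.hyps(1)])
  qed
  then show ?case by simp
qed

text \<open>Without any tree \<open>LEAST\<close> returns an unspecified number, so depth estimates
  come with some \<open>dt V k f\<close>, however large \<open>k\<close> is.\<close>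

definition dtdepth :: "nat set \<Rightarrow> boolfun \<Rightarrow> nat" where
  "dtdepth V f = (LEAST k. dt V k f)"

lemma dtdepth_le: "dt V k f \<Longrightarrow> dtdepth V f \<le> k"
  unfolding dtdepth_def by (rule Least_le)

lemma dt_dtdepth: "dt V k f \<Longrightarrow> dt V (dtdepth V f) f"
  unfolding dtdepth_def by (rule LeastI)

lemma dtdepth_not: "dtdepth V (\<lambda>x. \<not> f x) = dtdepth V f"
proof -
  have "dt V k (\<lambda>x. \<not> f x) \<longleftrightarrow> dt V k f" for k
    using dt_not[of V k f] dt_not[of V k "\<lambda>x. \<not> f x"] by auto
  then show ?thesis by (simp add: dtdepth_def)
qed

text \<open>The query costs a factor 4. Replacing the maximum over the branches by a sum lets
  expectations be taken branch by branch.\<close>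

lemma dtdepth_query:
  assumes "v \<in> V" "dt V k f"
  shows "(4::real) ^ dtdepth V f \<le> 4 * (4 ^ dtdepth V (fixv f v True) + 4 ^ dtdepth V (fixv f v False))"
proof -
  let ?a = "dtdepth V (fixv f v True)" and ?b = "dtdepth V (fixv f v False)"
  have "dt V ?a (fixv f v True)" "dt V ?b (fixv f v False)"
    using dt_dtdepth[OF dt_fixv[OF assms(2)]] by blast+
  then have "dt V (max ?a ?b) (fixv f v True)" "dt V (max ?a ?b) (fixv f v False)"
    by (auto elim: dt_mono)
  then have "dtdepth V f \<le> Suc (max ?a ?b)"
    by (intro dtdepth_le dt_query[OF assms(1)])
  then have "(4::real) ^ dtdepth V f \<le> 4 ^ Suc (max ?a ?b)"
    by (rule power_increasing) simp
  also have "\<dots> \<le> 4 * (4 ^ ?a + 4 ^ ?b)"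
    by (simp add: max_def)
  finally show ?thesis .
qed

section \<open>The switching lemma\<close>

definition term_fun :: "(nat \<times> bool) list \<Rightarrow> boolfun" where
  "term_fun ls x \<longleftrightarrow> (\<forall>(v, b)\<in>set ls. x v = b)"

definition dnf_fun :: "(nat \<times> bool) list list \<Rightarrow> boolfun" where
  "dnf_fun ts x \<longleftrightarrow> (\<exists>ls\<in>set ts. term_fun ls x)"

definition valid_term :: "nat set \<Rightarrow> nat \<Rightarrow> (nat \<times> bool) list \<Rightarrow> bool" where
  "valid_term V w ls \<longleftrightarrow> distinct (map fst ls) \<and> fst ` set ls \<subseteq> V \<and> length ls \<le> w"

text \<open>The number \<open>m\<close> of terms is the induction measure of the switching lemma,
  whose bound does not involve it.\<close>

definition is_dnf :: "nat set \<Rightarrow> nat \<Rightarrow> nat \<Rightarrow> boolfun \<Rightarrow> bool" where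
  "is_dnf V w m f \<longleftrightarrow> (\<exists>ts. length ts \<le> m \<and> (\<forall>ls\<in>set ts. valid_term V w ls) \<and> f = dnf_fun ts)"

definition fix_terms :: "nat \<Rightarrow> bool \<Rightarrow> (nat \<times> bool) list list \<Rightarrow> (nat \<times> bool) list list" where
  "fix_terms v b ts = map (filter (\<lambda>l. fst l \<noteq> v)) (filter (\<lambda>ls. (v, \<not> b) \<notin> set ls) ts)"

lemma dnf_fix_terms: "fixv (dnf_fun ts) v b = dnf_fun (fix_terms v b ts)"
proof
  fix x
  have "term_fun ls (x(v := b)) \<longleftrightarrow> (v, \<not> b) \<notin> set ls \<and> term_fun (filter (\<lambda>l. fst l \<noteq> v) ls) x" for ls
    by (auto simp: term_fun_def split: if_splits) (metis (full_types))+
  then show "fixv (dnf_fun ts) v b x = dnf_fun (fix_terms v b ts) x"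
    by (auto simp: fixv_def dnf_fun_def fix_terms_def)
qed

lemma valid_term_filter: "valid_term V w ls \<Longrightarrow> valid_term V w (filter P ls)"
  unfolding valid_term_def
  by (auto simp: distinct_map intro: inj_on_subset order.trans[OF length_filter_le])

lemma valid_fix_terms: "\<forall>ls\<in>set ts. valid_term V w ls \<Longrightarrow> \<forall>ls\<in>set (fix_terms v b ts). valid_term V w ls"
  by (auto simp: fix_terms_def valid_term_filter)

lemma length_fix_terms: "length (fix_terms v b ts) \<le> length ts"
  by (simp add: fix_terms_def)

lemma is_dnf_fixv: "is_dnf V w m f \<Longrightarrow> is_dnf V w m (fixv f v b)"
  unfolding is_dnf_def using dnf_fix_terms valid_fix_terms length_fix_terms order.trans by metis

lemma is_dnf_of_dt:
  assumes "dt V k f" shows "\<exists>m. is_dnf V k m f"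
proof -
  have "\<exists>ts. (\<forall>ls\<in>set ts. valid_term V k ls) \<and> f = dnf_fun ts"
    using assms
  proof (induction rule: dt.induct)
    case (dt_const f c k)
    then show ?case
      by (intro exI[of _ "if c then [[]] else []"])
         (auto simp: dnf_fun_def term_fun_def valid_term_def fun_eq_iff)
  next
    case (dt_query v k f)
    then obtain ts0 ts1 where
      1: "\<forall>ls\<in>set ts1. valid_term V k ls" "fixv f v True = dnf_fun ts1" and
      0: "\<forall>ls\<in>set ts0. valid_term V k ls" "fixv f v False = dnf_fun ts0" by auto
    \<comment> \<open>One term per accepting path. \<open>fix_terms\<close> strips \<open>v\<close>
      from the subformulas, since a valid term mentions no variable twice.\<close>
    let ?ts = "map ((#) (v, True)) (fix_terms v True ts1) @ map ((#) (v, False)) (fix_terms v False ts0)"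
    have val: "valid_term V (Suc k) ((v, b) # ls)" if "ls \<in> set (fix_terms v b ts)"
      "\<forall>ls\<in>set ts. valid_term V k ls" for b ls ts
    proof -
      have "valid_term V k ls" using that valid_fix_terms by blast
      moreover have "v \<notin> fst ` set ls" using that(1) by (auto simp: fix_terms_def)
      ultimately show ?thesis using dt_query.hyps(1) by (simp add: valid_term_def)
    qed
    have cons: "dnf_fun (map ((#) (v, b)) ts) x \<longleftrightarrow> x v = b \<and> dnf_fun ts x" for b ts x
      by (auto simp: dnf_fun_def term_fun_def)
    have app: "dnf_fun (ts @ us) x \<longleftrightarrow> dnf_fun ts x \<or> dnf_fun us x" for ts us x
      by (auto simp: dnf_fun_def)
    have "f x = dnf_fun ?ts x" for x
    proof -
      have "f x = fixv f v (x v) x" by (simp add: fixv_def)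
      moreover have "dnf_fun (fix_terms v True ts1) = fixv f v True"
        "dnf_fun (fix_terms v False ts0) = fixv f v False"
        using 0 1 dnf_fix_terms fixv_same by metis+
      ultimately show ?thesis unfolding app cons by (cases "x v") auto
    qed
    then show ?case
      using val 0 1 by (intro exI[of _ ?ts]) auto
  qed
  then show ?thesis unfolding is_dnf_def by blast
qed

lemma is_dnf_or:
  assumes "is_dnf V w m f" "is_dnf V w l g"
  shows "is_dnf V w (m + l) (\<lambda>x. f x \<or> g x)"
proof -
  from assms obtain ts us where "length ts \<le> m" "length us \<le> l" "f = dnf_fun ts" "g = dnf_fun us"
    "\<forall>ls\<in>set ts. valid_term V w ls" "\<forall>ls\<in>set us. valid_term V w ls"
    unfolding is_dnf_def by blast
  then show ?thesis
    unfolding is_dnf_def by (intro exI[of _ "ts @ us"]) (auto simp: dnf_fun_def fun_eq_iff)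
qed

lemma is_dnf_Bex:
  assumes "finite A" "\<And>j. j \<in> A \<Longrightarrow> dt V w (F j)"
  shows "\<exists>m. is_dnf V w m (\<lambda>x. \<exists>j\<in>A. F j x)"
  using assms
proof (induction A rule: finite_induct)
  case empty
  then show ?case by (auto simp: is_dnf_def dnf_fun_def fun_eq_iff intro!: exI[of _ "[]"])
next
  case (insert j A)
  then obtain m l where "is_dnf V w m (F j)" "is_dnf V w l (\<lambda>x. \<exists>j\<in>A. F j x)"
    using is_dnf_of_dt by blast
  from is_dnf_or[OF this] show ?case by auto
qed

text \<open>Needed so that \<open>dtdepth\<close> is a genuine depth in
  \<open>alive_mass_Cons\<close>.\<close>

lemma is_dnf_dt:
  assumes "is_dnf V w m f" shows "\<exists>k. dt V k f"
proof -
  obtain ts where ts: "\<forall>ls\<in>set ts. valid_term V w ls" "f = dnf_fun ts"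
    using assms by (auto simp: is_dnf_def)
  let ?W = "\<Union>ls\<in>set ts. fst ` set ls"
  have "dt V (card ?W) f"
  proof (rule dt_finite_support)
    show "?W \<subseteq> V" using ts by (auto simp: valid_term_def)
  next
    fix x y :: "nat \<Rightarrow> bool" assume "\<forall>i\<in>?W. x i = y i"
    then have "term_fun ls x = term_fun ls y" if "ls \<in> set ts" for ls
      using that by (fastforce simp: term_fun_def)
    then show "f x = f y" by (simp add: ts dnf_fun_def)
  qed simp
  then show ?thesis by blast
qed

definition is_zero :: "boolfun \<Rightarrow> bool" where
  "is_zero f \<longleftrightarrow> (\<forall>x. \<not> f x)"

text \<open>The yardstick for \<open>alive_mass\<close>: leaving a term alive is compared, literal
  by literal, with satisfying it.\<close>

definition sat_mass :: "real \<Rightarrow> nat list \<Rightarrow> (nat \<times> bool) list \<Rightarrow> boolfun \<Rightarrow> real" where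
  "sat_mass p vs ls G =
     rex p vs (\<lambda>\<rho>. of_bool (is_zero (restr \<rho> G) \<and> (\<forall>(v, b)\<in>set ls. \<rho> v = Some b)))"

definition alive_mass :: "real \<Rightarrow> nat list \<Rightarrow> (nat \<times> bool) list \<Rightarrow> boolfun \<Rightarrow> boolfun \<Rightarrow> real" where
  "alive_mass p vs ls F G =
     rex p vs (\<lambda>\<rho>. of_bool (is_zero (restr \<rho> G) \<and> \<not> is_zero (restr \<rho> (term_fun ls)))
       * 4 ^ dtdepth (set vs) (restr \<rho> F))"

lemma term_fun_upd: "v \<notin> fst ` set ls \<Longrightarrow> term_fun ls (x(v := b)) = term_fun ls x"
  unfolding term_fun_def
  by (intro ball_cong refl) (auto simp: image_iff split: prod.splits)

lemma sat_mass_Cons: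
  assumes "v \<in> set vs" "v \<notin> fst ` set ls"
  shows "sat_mass p vs ((v, b) # ls) G = (1 - p) / 2 * sat_mass p vs ls (fixv G v b)"
proof -
  have *: "(\<forall>(u, c)\<in>set ls. (\<rho>(v := a)) u = Some c) \<longleftrightarrow> (\<forall>(u, c)\<in>set ls. \<rho> u = Some c)" for \<rho> a
    by (intro ball_cong refl) (use assms(2) in \<open>auto simp: image_iff split: prod.splits\<close>)
  show ?thesis
    unfolding sat_mass_def
    by (subst rex_resample[OF assms(1)])
       (cases b; simp add: * restr_upd_Some del: fun_upd_apply; simp add: *)
qed

text \<open>The value \<open>b\<close> shortens the term, the other value falsifies it and
  contributes nothing, and a free \<open>v\<close> is queried at the price of a factor 4. In the
  last case G still vanishes once \<open>v\<close> is set to \<open>b\<close>, so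
  \<open>fixv G v b\<close> serves in every summand.\<close>

lemma alive_mass_Cons:
  assumes v: "v \<in> set vs" "v \<notin> fst ` set ls" and F: "dt (set vs) k F" and p: "0 \<le> p" "p \<le> 1"
  shows "alive_mass p vs ((v, b) # ls) F G \<le>
    4 * p * (alive_mass p vs ls (fixv F v True) (fixv G v b) + alive_mass p vs ls (fixv F v False) (fixv G v b))
    + (1 - p) / 2 * alive_mass p vs ls (fixv F v b) (fixv G v b)"
proof -
  define \<Phi> where "\<Phi> ls F G \<rho> = of_bool (is_zero (restr \<rho> G) \<and> \<not> is_zero (restr \<rho> (term_fun ls)))
       * (4::real) ^ dtdepth (set vs) (restr \<rho> F)" for ls F G \<rho>
  have X: "alive_mass p vs ls F G = rex p vs (\<Phi> ls F G)" for ls F G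
    unfolding alive_mass_def by (rule arg_cong[where f = "rex p vs"]) (auto simp: \<Phi>_def fun_eq_iff)
  have same: "fixv (term_fun ((v, b) # ls)) v b = term_fun ls"
    using term_fun_upd[OF v(2)] by (auto simp: fixv_def term_fun_def fun_eq_iff)
  have diff: "fixv (term_fun ((v, b) # ls)) v (\<not> b) = (\<lambda>_. False)"
    by (auto simp: fixv_def term_fun_def fun_eq_iff)
  have S1: "\<Phi> ((v, b) # ls) F G (\<rho>(v := Some b)) = \<Phi> ls (fixv F v b) (fixv G v b) \<rho>" for \<rho>
    by (simp add: \<Phi>_def restr_upd_Some same)
  have S2: "\<Phi> ((v, b) # ls) F G (\<rho>(v := Some (\<not> b))) = 0" for \<rho>
    unfolding \<Phi>_def restr_upd_Some diff by (simp add: is_zero_def restr_def)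
  have S3: "\<Phi> ((v, b) # ls) F G (\<rho>(v := None)) \<le>
     4 * (\<Phi> ls (fixv F v True) (fixv G v b) \<rho> + \<Phi> ls (fixv F v False) (fixv G v b) \<rho>)" for \<rho>
  proof (cases "is_zero (restr (\<rho>(v := None)) G) \<and> \<not> is_zero (restr (\<rho>(v := None)) (term_fun ((v, b) # ls)))")
    case False
    then show ?thesis by (auto simp: \<Phi>_def)
  next
    case True
    have "is_zero (restr \<rho> (fixv G v b))"
      using True unfolding fixv_restr_upd_None[symmetric] by (auto simp: is_zero_def fixv_def)
    moreover have "\<not> is_zero (restr \<rho> (term_fun ls))"
    proof -
      obtain x where "term_fun ((v, b) # ls) (comb (\<rho>(v := None)) x)"
        using True by (auto simp: is_zero_def restr_def)
      then have "term_fun ls (comb (\<rho>(v := None)) (x(v := x v)))" by (simp add: term_fun_def)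
      then have "term_fun ls (comb \<rho> x)"
        unfolding comb_upd_None term_fun_upd[OF v(2)] .
      then show ?thesis by (auto simp: is_zero_def restr_def)
    qed
    moreover have "(4::real) ^ dtdepth (set vs) (restr (\<rho>(v := None)) F) \<le>
        4 * (4 ^ dtdepth (set vs) (restr \<rho> (fixv F v True)) + 4 ^ dtdepth (set vs) (restr \<rho> (fixv F v False)))"
      using dtdepth_query[OF v(1) dt_restr[OF F, of "\<rho>(v := None)"]]
      unfolding fixv_restr_upd_None .
    ultimately show ?thesis by (simp add: \<Phi>_def)
  qed
  have "alive_mass p vs ((v, b) # ls) F G =
    p * rex p vs (\<lambda>\<rho>. \<Phi> ((v, b) # ls) F G (\<rho>(v := None))) +
    (1 - p) / 2 * (rex p vs (\<lambda>\<rho>. \<Phi> ((v, b) # ls) F G (\<rho>(v := Some b))) +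
                   rex p vs (\<lambda>\<rho>. \<Phi> ((v, b) # ls) F G (\<rho>(v := Some (\<not> b)))))"
    unfolding X by (subst rex_resample[OF v(1)]) (cases b; simp)
  also have "\<dots> = p * rex p vs (\<lambda>\<rho>. \<Phi> ((v, b) # ls) F G (\<rho>(v := None))) +
    (1 - p) / 2 * alive_mass p vs ls (fixv F v b) (fixv G v b)"
    by (simp add: S1 S2 X)
  finally have eq: "alive_mass p vs ((v, b) # ls) F G = \<dots>" .
  have "rex p vs (\<lambda>\<rho>. \<Phi> ((v, b) # ls) F G (\<rho>(v := None))) \<le>
    rex p vs (\<lambda>\<rho>. 4 * (\<Phi> ls (fixv F v True) (fixv G v b) \<rho> + \<Phi> ls (fixv F v False) (fixv G v b) \<rho>))"
    by (rule rex_mono[OF p S3])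
  also have "\<dots> = 4 * (alive_mass p vs ls (fixv F v True) (fixv G v b) + alive_mass p vs ls (fixv F v False) (fixv G v b))"
    by (simp add: X rex_mult rex_add)
  finally have "p * rex p vs (\<lambda>\<rho>. \<Phi> ((v, b) # ls) F G (\<rho>(v := None))) \<le> p * \<dots>"
    using p(1) by (rule mult_left_mono)
  then show ?thesis
    unfolding eq by (simp add: mult_ac)
qed

text \<open>\<open>IH\<close> is the switching lemma for \<open>m\<close> terms. By
  \<open>qr\<close>, \<open>r\<close> is the price of one literal: satisfied with probability (1 -
  p) / 2, or free with weight 8 p from its two branches, relative to satisfied.\<close>

context
  fixes p r :: real and vs :: "nat list" and w m :: nat
  assumes p: "0 < p" "p < 1" and r: "r = 1 + 16 * p / (1 - p)"
    and IH: "\<And>F G. is_dnf (set vs) w m F \<Longrightarrow>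
      rex p vs (\<lambda>\<rho>. of_bool (is_zero (restr \<rho> G)) * 4 ^ dtdepth (set vs) (restr \<rho> F))
        \<le> 2 * rex p vs (\<lambda>\<rho>. of_bool (is_zero (restr \<rho> G)))"
begin

lemma qr: "(1 - p) / 2 * r = (1 - p) / 2 + 8 * p"
proof -
  have "1 - p \<noteq> 0" using p by simp
  then show ?thesis by (simp add: r distrib_left)
qed

lemma sat_mass_nonneg: "0 \<le> sat_mass p vs ls G"
  unfolding sat_mass_def using p by (intro rex_nonneg) auto

lemma not_zero_Nil: "\<not> is_zero (restr \<rho> (term_fun []))"
  by (simp add: is_zero_def restr_def term_fun_def)

lemma alive_mass_le:
  assumes "distinct (map fst ls)" "fst ` set ls \<subseteq> set vs" "is_dnf (set vs) w m F"
  shows "alive_mass p vs ls F G \<le> 2 * r ^ length ls * sat_mass p vs ls G"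
  using assms
proof (induction ls arbitrary: F G)
  case Nil
  then show ?case using IH[of F G] by (simp add: alive_mass_def sat_mass_def not_zero_Nil)
next
  case (Cons l ls)
  obtain v b where l: "l = (v, b)" by force
  have v: "v \<in> set vs" "v \<notin> fst ` set ls" using Cons.prems l by auto
  obtain k where k: "dt (set vs) k F" using Cons.prems is_dnf_dt by blast
  let ?N = "2 * r ^ length ls * sat_mass p vs ls (fixv G v b)"
  have *: "alive_mass p vs ls (fixv F v c) (fixv G v b) \<le> ?N" for c
    using Cons.prems by (intro Cons.IH is_dnf_fixv) auto
  have "alive_mass p vs (l # ls) F G \<le> 4 * p * (?N + ?N) + (1 - p) / 2 * ?N"
    unfolding l using p
    by (intro order.trans[OF alive_mass_Cons[OF v k]] add_mono mult_left_mono *) auto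
  also have "\<dots> = ((1 - p) / 2 + 8 * p) * ?N" by (simp add: field_simps)
  also have "\<dots> = 2 * r ^ length (l # ls) * sat_mass p vs (l # ls) G"
    unfolding qr[symmetric] l sat_mass_Cons[OF v] by simp
  finally show ?case .
qed

text \<open>The gain of 1 over \<open>alive_mass_le\<close> comes from the empty term, where the
  disjunction is constantly true and has depth 0. Along the term, the branch agreeing with the
  literal keeps the shape of the disjunction, while the other branch leaves only a cofactor of
  \<open>F'\<close>, to which \<open>alive_mass_le\<close> applies.\<close>

lemma alive_mass_term_le:
  assumes "distinct (map fst ls)" "fst ` set ls \<subseteq> set vs" "is_dnf (set vs) w m F'"
  shows "alive_mass p vs ls (\<lambda>x. term_fun ls x \<or> F' x) G \<le> (2 * r ^ length ls - 1) * sat_mass p vs ls G"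
  using assms
proof (induction ls arbitrary: F' G)
  case Nil
  have "dtdepth (set vs) (restr \<rho> (\<lambda>x. term_fun [] x \<or> F' x)) = 0" for \<rho>
    using dtdepth_le[OF dt_const[of "restr \<rho> (\<lambda>x. term_fun [] x \<or> F' x)" True _ 0]]
    by (simp add: restr_def term_fun_def)
  then show ?case by (simp add: alive_mass_def sat_mass_def not_zero_Nil)
next
  case (Cons l ls)
  obtain v b where l: "l = (v, b)" by force
  have v: "v \<in> set vs" "v \<notin> fst ` set ls" using Cons.prems l by auto
  let ?F = "\<lambda>x. term_fun (l # ls) x \<or> F' x"
  obtain k where k: "dt (set vs) k ?F"
  proof -
    have "is_dnf (set vs) (length (l # ls)) 1 (term_fun (l # ls))"
      using Cons.prems unfolding is_dnf_def
      by (intro exI[of _ "[l # ls]"]) (auto simp: valid_term_def dnf_fun_def fun_eq_iff)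
    then obtain k1 where k1: "dt (set vs) k1 (term_fun (l # ls))" using is_dnf_dt by blast
    obtain k2 where k2: "dt (set vs) k2 F'" using Cons.prems is_dnf_dt by blast
    have "dt (set vs) (sum_list [k1, k2]) ?F"
      by (rule dt_determined[where \<alpha>s = "[term_fun (l # ls), F']"]) (use k1 k2 in auto)
    then show ?thesis using that by blast
  qed
  let ?S = "sat_mass p vs ls (fixv G v b)"
  have "fixv ?F v b = (\<lambda>x. term_fun ls x \<or> fixv F' v b x)"
    using term_fun_upd[OF v(2)] by (auto simp: l fixv_def term_fun_def fun_eq_iff)
  then have same: "alive_mass p vs ls (fixv ?F v b) (fixv G v b) \<le> (2 * r ^ length ls - 1) * ?S"
    using Cons.IH[of "fixv F' v b" "fixv G v b"] Cons.prems by (simp add: is_dnf_fixv)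
  have "fixv ?F v (\<not> b) = fixv F' v (\<not> b)"
    by (auto simp: l fixv_def term_fun_def fun_eq_iff)
  then have diff: "alive_mass p vs ls (fixv ?F v (\<not> b)) (fixv G v b) \<le> 2 * r ^ length ls * ?S"
    using Cons.prems by (auto intro!: alive_mass_le is_dnf_fixv)
  have sum: "alive_mass p vs ls (fixv ?F v True) (fixv G v b) + alive_mass p vs ls (fixv ?F v False) (fixv G v b)
    \<le> (2 * r ^ length ls - 1) * ?S + 2 * r ^ length ls * ?S"
    using same diff by (cases b) auto
  have S: "0 \<le> ?S" by (rule sat_mass_nonneg)
  have "alive_mass p vs (l # ls) ?F G \<le>
     4 * p * ((2 * r ^ length ls - 1) * ?S + 2 * r ^ length ls * ?S) + (1 - p) / 2 * ((2 * r ^ length ls - 1) * ?S)"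
    using p unfolding l
    by (intro order.trans[OF alive_mass_Cons[OF v k[unfolded l]]] add_mono mult_left_mono
        sum[unfolded l] same[unfolded l]) auto
  also have "\<dots> = 2 * (((1 - p) / 2 + 8 * p) * r ^ length ls) * ?S - (1 - p) / 2 * ?S - 4 * p * ?S"
    by (simp add: field_simps)
  also have "\<dots> \<le> 2 * (((1 - p) / 2 + 8 * p) * r ^ length ls) * ?S - (1 - p) / 2 * ?S"
    using p S by simp
  also have "\<dots> = (2 * r ^ length (l # ls) - 1) * sat_mass p vs (l # ls) G"
    unfolding qr[symmetric] l sat_mass_Cons[OF v] by (simp add: field_simps)
  finally show ?case .
qed

end

text \<open>The conditioning on \<open>G\<close> vanishing carries the information that the earlier terms of the
  formula were falsified; it is preserved when free variables are fixed, which is what makes the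
  induction over the terms work.\<close>

lemma switching:
  assumes p: "0 < p" "p < 1" and rw: "(1 + 16 * p / (1 - p)) ^ w \<le> 3 / 2"
    and "is_dnf (set vs) w m F"
  shows "rex p vs (\<lambda>\<rho>. of_bool (is_zero (restr \<rho> G)) * 4 ^ dtdepth (set vs) (restr \<rho> F))
        \<le> 2 * rex p vs (\<lambda>\<rho>. of_bool (is_zero (restr \<rho> G)))"
  using assms(4)
proof (induction m arbitrary: F G)
  case 0
  then have "restr \<rho> F x = False" for \<rho> x
    by (auto simp: is_dnf_def dnf_fun_def restr_def)
  then have "dtdepth (set vs) (restr \<rho> F) = 0" for \<rho>
    using dtdepth_le[OF dt_const[of "restr \<rho> F" False _ 0]] by simp
  moreover have "0 \<le> rex p vs (\<lambda>\<rho>. of_bool (is_zero (restr \<rho> G)))"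
    using p by (intro rex_nonneg) auto
  ultimately show ?case by simp
next
  case (Suc m)
  define r where "r = 1 + 16 * p / (1 - p)"
  obtain ts where ts: "length ts \<le> Suc m" "\<forall>ls\<in>set ts. valid_term (set vs) w ls" "F = dnf_fun ts"
    using Suc.prems by (auto simp: is_dnf_def)
  show ?case
  proof (cases ts)
    case Nil
    then have "is_dnf (set vs) w m F" using ts by (auto simp: is_dnf_def intro!: exI[of _ "[]"])
    then show ?thesis by (rule Suc.IH)
  next
    case (Cons ls us)
    let ?V = "set vs" and ?H = "\<lambda>x. G x \<or> term_fun ls x"
    have F': "is_dnf ?V w m (dnf_fun us)" using ts Cons by (auto simp: is_dnf_def)
    have F: "F = (\<lambda>x. term_fun ls x \<or> dnf_fun us x)"
      using ts Cons by (auto simp: dnf_fun_def fun_eq_iff)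
    have ls: "distinct (map fst ls)" "fst ` set ls \<subseteq> ?V" "length ls \<le> w"
      using ts Cons by (auto simp: valid_term_def)
    have H: "is_zero (restr \<rho> ?H) \<longleftrightarrow> is_zero (restr \<rho> G) \<and> is_zero (restr \<rho> (term_fun ls))" for \<rho>
      by (auto simp: is_zero_def restr_def)
    have eqF: "restr \<rho> F = restr \<rho> (dnf_fun us)" if "is_zero (restr \<rho> (term_fun ls))" for \<rho>
      using that by (auto simp: F restr_def is_zero_def fun_eq_iff)
    \<comment> \<open>Either the first term is falsified, and then it joins G and only the other
      terms matter, or it is alive.\<close>
    have split: "of_bool (is_zero (restr \<rho> G)) * (4::real) ^ dtdepth ?V (restr \<rho> F) =
       of_bool (is_zero (restr \<rho> ?H)) * 4 ^ dtdepth ?V (restr \<rho> (dnf_fun us)) +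
       of_bool (is_zero (restr \<rho> G) \<and> \<not> is_zero (restr \<rho> (term_fun ls))) * 4 ^ dtdepth ?V (restr \<rho> F)" for \<rho>
      using eqF[of \<rho>] by (auto simp: H)
    have "rex p vs (\<lambda>\<rho>. of_bool (is_zero (restr \<rho> G)) * 4 ^ dtdepth ?V (restr \<rho> F)) =
      rex p vs (\<lambda>\<rho>. of_bool (is_zero (restr \<rho> ?H)) * 4 ^ dtdepth ?V (restr \<rho> (dnf_fun us))) +
      alive_mass p vs ls F G"
      unfolding split rex_add alive_mass_def ..
    also have "\<dots> \<le> 2 * rex p vs (\<lambda>\<rho>. of_bool (is_zero (restr \<rho> ?H))) + (2 * r ^ length ls - 1) * sat_mass p vs ls G"
      unfolding F
      by (intro add_mono Suc.IH[OF F'] alive_mass_term_le[where w = w and m = m] p r_def Suc.IH ls F')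
    \<comment> \<open>With r^w <= 3/2 the factor is 2 * 3/2 - 1 = 2: the saved 1 closes the
      induction.\<close>
    also have "(2 * r ^ length ls - 1) * sat_mass p vs ls G \<le> 2 * sat_mass p vs ls G"
    proof (rule mult_right_mono)
      have "r ^ length ls \<le> r ^ w"
        using p ls(3) by (intro power_increasing) (auto simp: r_def)
      then show "2 * r ^ length ls - 1 \<le> 2" using rw by (simp add: r_def)
      show "0 \<le> sat_mass p vs ls G"
        unfolding sat_mass_def using p by (intro rex_nonneg) auto
    qed
    \<comment> \<open>A satisfied term is alive, so the two parts are bounded by disjoint events
      that together say that G vanishes.\<close>
    also have "sat_mass p vs ls G \<le>
      rex p vs (\<lambda>\<rho>. of_bool (is_zero (restr \<rho> G) \<and> \<not> is_zero (restr \<rho> (term_fun ls))))"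
      unfolding sat_mass_def
    proof (rule rex_mono)
      fix \<rho> :: "nat \<Rightarrow> bool option"
      have "term_fun ls (comb \<rho> x)" if "\<forall>(v, b)\<in>set ls. \<rho> v = Some b" for x
        using that by (fastforce simp: term_fun_def comb_def)
      then show "of_bool (is_zero (restr \<rho> G) \<and> (\<forall>(v, b)\<in>set ls. \<rho> v = Some b))
        \<le> (of_bool (is_zero (restr \<rho> G) \<and> \<not> is_zero (restr \<rho> (term_fun ls))) :: real)"
        by (auto simp: is_zero_def restr_def)
    qed (use p in auto)
    also have "2 * rex p vs (\<lambda>\<rho>. of_bool (is_zero (restr \<rho> ?H))) +
        2 * rex p vs (\<lambda>\<rho>. of_bool (is_zero (restr \<rho> G) \<and> \<not> is_zero (restr \<rho> (term_fun ls))))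
      = 2 * rex p vs (\<lambda>\<rho>. of_bool (is_zero (restr \<rho> ?H)) +
          of_bool (is_zero (restr \<rho> G) \<and> \<not> is_zero (restr \<rho> (term_fun ls))))"
      by (simp add: rex_add)
    also have "(\<lambda>\<rho>. of_bool (is_zero (restr \<rho> ?H)) +
          (of_bool (is_zero (restr \<rho> G) \<and> \<not> is_zero (restr \<rho> (term_fun ls))) :: real)) =
       (\<lambda>\<rho>. of_bool (is_zero (restr \<rho> G)))"
      by (auto simp: H fun_eq_iff)
    finally show ?thesis by simp
  qed
qed

text \<open>With survival probability 1 / (64 w) the power is at most exp (16 / 63).\<close>

lemma switching_param:
  assumes "w \<ge> 1"
  shows "(1 + 16 * (1 / (64 * real w)) / (1 - 1 / (64 * real w))) ^ w \<le> 3 / 2"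
proof -
  have w: "real w \<ge> 1" using assms by simp
  have "16 * (1 / (64 * real w)) / (1 - 1 / (64 * real w)) = 16 / (64 * real w - 1)"
    using w by (simp add: field_simps)
  also have "\<dots> \<le> 16 / (63 * real w)"
    using w by (intro divide_left_mono) auto
  finally have "(1 + 16 * (1 / (64 * real w)) / (1 - 1 / (64 * real w))) ^ w \<le> (1 + 16 / (63 * real w)) ^ w"
    using w by (intro power_mono) auto
  also have "\<dots> \<le> exp (16 / (63 * real w)) ^ w"
    using w by (intro power_mono exp_ge_add_one_self) auto
  also have "\<dots> = exp (16 / 63)"
    using w by (simp add: exp_of_nat_mult[symmetric])
  also have "\<dots> \<le> 1 + 16 / 63 + (16 / 63)\<^sup>2"
    by (rule exp_bound) auto
  also have "\<dots> \<le> 3 / 2" by (simp add: power2_eq_square)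
  finally show ?thesis .
qed

text \<open>Trees of depth \<open>w\<close> are DNFs of width \<open>w\<close>, and so is their
  disjunction. Taking G constantly false makes the condition in \<open>switching\<close> hold for
  every restriction.\<close>

lemma switching_or:
  assumes "w \<ge> 1" "finite A" "\<And>j. j \<in> A \<Longrightarrow> dt (set vs) w (F j)"
  shows "rex (1 / (64 * real w)) vs (\<lambda>\<rho>. 4 ^ dtdepth (set vs) (restr \<rho> (\<lambda>x. \<exists>j\<in>A. F j x))) \<le> 2"
proof -
  obtain m where m: "is_dnf (set vs) w m (\<lambda>x. \<exists>j\<in>A. F j x)"
    using is_dnf_Bex assms(2,3) by blast
  have "real w \<ge> 1" using assms(1) by simp
  then have p: "0 < 1 / (64 * real w)" "1 / (64 * real w) < 1" by (auto simp: field_simps)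
  show ?thesis
    using switching[OF p switching_param[OF assms(1)] m, of "\<lambda>_. False"]
    by (simp add: is_zero_def restr_def)
qed

lemma switching_and:
  assumes "w \<ge> 1" "finite A" "\<And>j. j \<in> A \<Longrightarrow> dt (set vs) w (F j)"
  shows "rex (1 / (64 * real w)) vs (\<lambda>\<rho>. 4 ^ dtdepth (set vs) (restr \<rho> (\<lambda>x. \<forall>j\<in>A. F j x))) \<le> 2"
proof -
  have "restr \<rho> (\<lambda>x. \<forall>j\<in>A. F j x) = (\<lambda>x. \<not> restr \<rho> (\<lambda>x. \<exists>j\<in>A. \<not> F j x) x)" for \<rho>
    by (simp add: restr_def)
  then show ?thesis
    using switching_or[OF assms(1,2), of vs "\<lambda>j x. \<not> F j x"] dt_not[OF assms(3)]
    by (simp add: dtdepth_not)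
qed

section \<open>Second-order Taylor expansion in the bias\<close>

text \<open>The slope may depend on the function but not on \<theta>; otherwise a positive and a
  negative bias could not cancel.\<close>

definition taylor2 :: "nat list \<Rightarrow> boolfun \<Rightarrow> real \<Rightarrow> real \<Rightarrow> bool" where
  "taylor2 vs f K r \<longleftrightarrow> (\<exists>b. \<forall>\<theta>. \<bar>\<theta>\<bar> \<le> r \<longrightarrow>
     \<bar>bex \<theta> vs (\<lambda>x. of_bool (f x)) - bex 0 vs (\<lambda>x. of_bool (f x)) - b * \<theta>\<bar> \<le> K * \<theta>\<^sup>2)"

lemma taylor2_mono: "taylor2 vs f K r \<Longrightarrow> K \<le> K' \<Longrightarrow> r' \<le> r \<Longrightarrow> taylor2 vs f K' r'"
  unfolding taylor2_def by (meson mult_right_mono order.trans zero_le_power2)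

lemma bex_of_bool_bounds:
  assumes "\<bar>\<theta>\<bar> \<le> 1"
  shows "0 \<le> bex \<theta> vs (\<lambda>x. of_bool (f x))" "bex \<theta> vs (\<lambda>x. of_bool (f x)) \<le> 1"
  using bex_mono[OF assms, of "\<lambda>_. 0" "\<lambda>x. of_bool (f x)" vs]
    bex_mono[OF assms, of "\<lambda>x. of_bool (f x)" "\<lambda>_. 1" vs] by auto

text \<open>The slope bound is carried along because recombining the cofactors creates the term (b1
  - b0) / 2 times \<theta>^2; then k^2 + k <= (k + 1)^2.\<close>

lemma dt_taylor2_slope:
  assumes "dt (set vs) k f"
  shows "\<exists>b. \<bar>b\<bar> \<le> real k \<and> (\<forall>\<theta>. \<bar>\<theta>\<bar> \<le> 1 \<longrightarrow>
     \<bar>bex \<theta> vs (\<lambda>x. of_bool (f x)) - bex 0 vs (\<lambda>x. of_bool (f x)) - b * \<theta>\<bar> \<le> (real k)\<^sup>2 * \<theta>\<^sup>2)"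
  using assms
proof (induction rule: dt.induct)
  case (dt_const f c k)
  then show ?case by (intro exI[of _ 0]) simp
next
  case (dt_query v k f)
  define g where "g f \<theta> = bex \<theta> vs (\<lambda>x. of_bool (f x))" for f :: boolfun and \<theta>
  let ?f1 = "fixv f v True" and ?f0 = "fixv f v False"
  have g: "g f \<theta> = (1 + \<theta>) / 2 * g ?f1 \<theta> + (1 - \<theta>) / 2 * g ?f0 \<theta>" for \<theta>
    unfolding g_def by (subst bex_resample[OF dt_query.hyps(1)]) (simp add: fixv_def)
  obtain b1 b0 where
    b1: "\<bar>b1\<bar> \<le> real k" "\<And>\<theta>. \<bar>\<theta>\<bar> \<le> 1 \<Longrightarrow> \<bar>g ?f1 \<theta> - g ?f1 0 - b1 * \<theta>\<bar> \<le> (real k)\<^sup>2 * \<theta>\<^sup>2" and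
    b0: "\<bar>b0\<bar> \<le> real k" "\<And>\<theta>. \<bar>\<theta>\<bar> \<le> 1 \<Longrightarrow> \<bar>g ?f0 \<theta> - g ?f0 0 - b0 * \<theta>\<bar> \<le> (real k)\<^sup>2 * \<theta>\<^sup>2"
    using dt_query.IH unfolding g_def by auto
  \<comment> \<open>The derivative at 0 of the recombined expectation, by the product rule.\<close>
  define b where "b = (b1 + b0) / 2 + (g ?f1 0 - g ?f0 0) / 2"
  have "\<bar>g ?f1 0 - g ?f0 0\<bar> \<le> 1"
    using bex_of_bool_bounds[of 0 vs ?f1] bex_of_bool_bounds[of 0 vs ?f0] unfolding g_def by simp
  then have "\<bar>b\<bar> \<le> real (Suc k)"
    using b1(1) b0(1) unfolding b_def abs_le_iff by (auto simp: field_simps)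
  moreover have "\<bar>g f \<theta> - g f 0 - b * \<theta>\<bar> \<le> (real (Suc k))\<^sup>2 * \<theta>\<^sup>2" if \<theta>: "\<bar>\<theta>\<bar> \<le> 1" for \<theta>
  proof -
    define R1 where "R1 = g ?f1 \<theta> - g ?f1 0 - b1 * \<theta>"
    define R0 where "R0 = g ?f0 \<theta> - g ?f0 0 - b0 * \<theta>"
    let ?B = "(real k)\<^sup>2 * \<theta>\<^sup>2"
    have R: "\<bar>R1\<bar> \<le> ?B" "\<bar>R0\<bar> \<le> ?B" using b1(2)[OF \<theta>] b0(2)[OF \<theta>] by (auto simp: R1_def R0_def)
    have "g f \<theta> - g f 0 - b * \<theta> = (1 + \<theta>) / 2 * R1 + (1 - \<theta>) / 2 * R0 + (b1 - b0) / 2 * \<theta>\<^sup>2"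
      unfolding g[of \<theta>] g[of 0] R1_def R0_def b_def by (simp add: field_simps power2_eq_square)
    also have "\<bar>\<dots>\<bar> \<le> \<bar>(1 + \<theta>) / 2 * R1\<bar> + \<bar>(1 - \<theta>) / 2 * R0\<bar> + \<bar>(b1 - b0) / 2 * \<theta>\<^sup>2\<bar>"
      by linarith
    also have "\<dots> = (1 + \<theta>) / 2 * \<bar>R1\<bar> + (1 - \<theta>) / 2 * \<bar>R0\<bar> + \<bar>(b1 - b0) / 2\<bar> * \<theta>\<^sup>2"
      using \<theta> by (simp add: abs_mult)
    also have "\<dots> \<le> (1 + \<theta>) / 2 * ?B + (1 - \<theta>) / 2 * ?B + real k * \<theta>\<^sup>2"
      using \<theta> R b1(1) b0(1) by (intro add_mono mult_left_mono mult_right_mono) auto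
    also have "\<dots> = ((real k)\<^sup>2 + real k) * \<theta>\<^sup>2"
      by (simp add: field_simps)
    also have "\<dots> \<le> (real (Suc k))\<^sup>2 * \<theta>\<^sup>2"
      by (intro mult_right_mono) (simp_all add: power2_eq_square algebra_simps)
    finally show ?thesis .
  qed
  ultimately show ?case unfolding g_def by blast
qed

lemma dt_taylor2: "dt (set vs) k f \<Longrightarrow> taylor2 vs f ((real k)\<^sup>2) 1"
  using dt_taylor2_slope[of vs k f] unfolding taylor2_def by blast

text \<open>Every restriction brings its own remainder and only the average counts. The bias seen by
  the free variables is \<theta> / p, whence the factor 1 / p^2 and the smaller radius.\<close>

lemma taylor2_restr:
  assumes p: "0 < p" "p \<le> 1" and t: "\<And>\<rho>. taylor2 vs (restr \<rho> f) (K \<rho>) r"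
  shows "taylor2 vs f (rex p vs K / p\<^sup>2) (p * r)"
proof -
  define g where "g f \<theta> = bex \<theta> vs (\<lambda>x. of_bool (f x))" for f :: boolfun and \<theta>
  obtain b where b: "\<And>\<rho> \<theta>. \<bar>\<theta>\<bar> \<le> r \<Longrightarrow> \<bar>g (restr \<rho> f) \<theta> - g (restr \<rho> f) 0 - b \<rho> * \<theta>\<bar> \<le> K \<rho> * \<theta>\<^sup>2"
    using t unfolding taylor2_def g_def by metis
  have g: "g f \<theta> = rex p vs (\<lambda>\<rho>. g (restr \<rho> f) (\<theta> / p))" for \<theta>
    using bex_scale[of p "\<theta> / p" vs] p unfolding g_def restr_def by simp
  have "\<bar>g f \<theta> - g f 0 - rex p vs b / p * \<theta>\<bar> \<le> rex p vs K / p\<^sup>2 * \<theta>\<^sup>2" if \<theta>: "\<bar>\<theta>\<bar> \<le> p * r" for \<theta>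
  proof -
    have \<theta>': "\<bar>\<theta> / p\<bar> \<le> r" using \<theta> p by (simp add: field_simps)
    have "g f \<theta> - g f 0 - rex p vs b / p * \<theta> =
        rex p vs (\<lambda>\<rho>. g (restr \<rho> f) (\<theta> / p) - g (restr \<rho> f) 0 - \<theta> / p * b \<rho>)"
      unfolding g[of \<theta>] g[of 0] rex_diff rex_mult by simp
    also have "\<bar>\<dots>\<bar> \<le> rex p vs (\<lambda>\<rho>. \<bar>g (restr \<rho> f) (\<theta> / p) - g (restr \<rho> f) 0 - \<theta> / p * b \<rho>\<bar>)"
      using p by (intro rex_abs) auto
    also have "\<dots> \<le> rex p vs (\<lambda>\<rho>. (\<theta> / p)\<^sup>2 * K \<rho>)"
      using p b[OF \<theta>'] by (intro rex_mono) (auto simp: mult.commute)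
    also have "\<dots> = rex p vs K / p\<^sup>2 * \<theta>\<^sup>2"
      unfolding rex_mult by (simp add: power_divide)
    finally show ?thesis .
  qed
  then show ?thesis unfolding taylor2_def g_def by blast
qed

section \<open>Bounded-depth circuits under random restrictions\<close>

text \<open>Input nodes are left unconstrained, so the property survives restrictions, which turn
  inputs into constants.\<close>

definition computes :: "nat \<Rightarrow> gate list \<Rightarrow> (nat \<Rightarrow> boolfun) \<Rightarrow> bool" where
  "computes n gs \<phi> \<longleftrightarrow> (\<forall>k<length gs. \<phi> (n + k) = (case gs ! k of
      NotG j \<Rightarrow> (\<lambda>x. \<not> \<phi> j x)
    | AndG js \<Rightarrow> (\<lambda>x. \<forall>j\<in>set js. \<phi> j x)
    | OrG js \<Rightarrow> (\<lambda>x. \<exists>j\<in>set js. \<phi> j x)))"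

text \<open>NOT gates keep the height, so the nodes of height 0 are inputs under chains of
  negations, that is, literals.\<close>

definition layered :: "nat \<Rightarrow> gate list \<Rightarrow> (nat \<Rightarrow> nat) \<Rightarrow> bool" where
  "layered n gs h \<longleftrightarrow> (\<forall>i<n. h i = 0) \<and> (\<forall>k<length gs. gate_args (gs ! k) \<subseteq> {..<n + k} \<and>
     (case gs ! k of NotG j \<Rightarrow> h (n + k) = h j
      | AndG js \<Rightarrow> 0 < h (n + k) \<and> (\<forall>j\<in>set js. h j < h (n + k))
      | OrG js \<Rightarrow> 0 < h (n + k) \<and> (\<forall>j\<in>set js. h j < h (n + k))))"

text \<open>The part of a gate that reads literals. Gates at any depth may read inputs directly, so it is
  these functions, not the gates of depth one, that determine the whole circuit.\<close>

definition bottom :: "gate list \<Rightarrow> (nat \<Rightarrow> nat) \<Rightarrow> (nat \<Rightarrow> boolfun) \<Rightarrow> nat \<Rightarrow> boolfun" where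
  "bottom gs h \<phi> k = (case gs ! k of
      NotG j \<Rightarrow> (\<lambda>x. \<exists>j\<in>{}. \<phi> j x)
    | AndG js \<Rightarrow> (\<lambda>x. \<forall>j\<in>{j\<in>set js. h j = 0}. \<phi> j x)
    | OrG js \<Rightarrow> (\<lambda>x. \<exists>j\<in>{j\<in>set js. h j = 0}. \<phi> j x))"

definition shallow :: "nat set \<Rightarrow> nat \<Rightarrow> gate list \<Rightarrow> (nat \<Rightarrow> nat) \<Rightarrow> nat \<Rightarrow> nat \<Rightarrow> (nat \<Rightarrow> boolfun) \<Rightarrow> bool" where
  "shallow V n gs h w j \<phi> \<longleftrightarrow> (\<forall>i<n + length gs. h i \<le> j \<longrightarrow> dt V w (\<phi> i))"

lemma computes_restr: "computes n gs \<phi> \<Longrightarrow> computes n gs (\<lambda>i. restr \<rho> (\<phi> i))"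
  by (auto simp: computes_def restr_def split: gate.splits)

lemma bottom_restr: "bottom gs h (\<lambda>i. restr \<rho> (\<phi> i)) k = restr \<rho> (bottom gs h \<phi> k)"
  by (auto simp: bottom_def restr_def split: gate.splits)

lemma node_cases [consumes 3, case_names input Not And Or]:
  assumes "layered n gs h" "computes n gs \<phi>" "i < n + length gs"
  obtains "i < n" "h i = 0"
  | j where "j < i" "n \<le> i" "gs ! (i - n) = NotG j" "h i = h j" "\<phi> i = (\<lambda>x. \<not> \<phi> j x)"
  | js where "n \<le> i" "gs ! (i - n) = AndG js" "\<phi> i = (\<lambda>x. \<forall>j\<in>set js. \<phi> j x)" "0 < h i"
      "\<And>j. j \<in> set js \<Longrightarrow> j < i \<and> h j < h i"
  | js where "n \<le> i" "gs ! (i - n) = OrG js" "\<phi> i = (\<lambda>x. \<exists>j\<in>set js. \<phi> j x)" "0 < h i"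
      "\<And>j. j \<in> set js \<Longrightarrow> j < i \<and> h j < h i"
proof (cases "i < n")
  case True
  then show ?thesis using assms that(1) by (auto simp: layered_def)
next
  case False
  define k where "k = i - n"
  have k: "i = n + k" "k < length gs" using False assms(3) by (auto simp: k_def)
  show ?thesis
  proof (cases "gs ! k")
    case (NotG j)
    then show ?thesis using assms k that(2)[of j] by (force simp: layered_def computes_def)
  next
    case (AndG js)
    then show ?thesis using assms k that(3)[of js] by (force simp: layered_def computes_def)
  next
    case (OrG js)
    then show ?thesis using assms k that(4)[of js] by (force simp: layered_def computes_def)
  qed
qed

text \<open>An AND or OR gate of height at most j + 1 reads only nodes of height at most j, so the
  switching lemma applies. NOT gates pass the bound on at equal height, hence the induction on the
  node number.\<close>

lemma node_switching:
  assumes "layered n gs h" "computes n gs \<phi>" "shallow (set vs) n gs h w j \<phi>" "w \<ge> 1"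
    and "i < n + length gs" "h i \<le> Suc j"
  shows "rex (1 / (64 * real w)) vs (\<lambda>\<rho>. 4 ^ dtdepth (set vs) (restr \<rho> (\<phi> i))) \<le> 2"
  using assms(5,6)
proof (induction i rule: less_induct)
  case (less i)
  show ?case
  proof (cases "h i \<le> j")
    case True
    then have "dt (set vs) w (\<phi> i)" using assms(3) less.prems by (auto simp: shallow_def)
    \<comment> \<open>A single shallow tree is a disjunction over one index.\<close>
    then show ?thesis using switching_or[OF assms(4), of "{0::nat}" vs "\<lambda>_. \<phi> i"] by simp
  next
    case False
    have dt: "dt (set vs) w (\<phi> l)" if "l < i" "h l < h i" for l
      using that assms(3) less.prems by (auto simp: shallow_def)
    from assms(1,2) less.prems(1) show ?thesis
    proof (cases rule: node_cases)
      case input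
      then show ?thesis using False by simp
    next
      case (Not l)
      have "restr \<rho> (\<phi> i) = (\<lambda>x. \<not> restr \<rho> (\<phi> l) x)" for \<rho> by (simp add: Not restr_def)
      then show ?thesis using Not less by (simp add: dtdepth_not)
    next
      case (And js)
      then show ?thesis using switching_and[OF assms(4), of "set js" vs \<phi>] dt by simp
    next
      case (Or js)
      then show ?thesis using switching_or[OF assms(4), of "set js" vs \<phi>] dt by simp
    qed
  qed
qed

lemma dt_literal:
  assumes "layered n gs h" "computes n gs \<phi>" "\<And>i. i < n \<Longrightarrow> dt V 1 (\<phi> i)"
    and "i < n + length gs" "h i = 0"
  shows "dt V 1 (\<phi> i)"
  using assms(4,5)
proof (induction i rule: less_induct)
  case (less i)
  from assms(1,2) less.prems(1) show ?case
  proof (cases rule: node_cases)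
    case (Not j)
    then show ?thesis using less by (auto intro!: dt_not)
  qed (use less.prems assms(3) in auto)
qed

text \<open>Literals have depth 1, so a constant survival probability suffices: this round costs no
  factor log S.\<close>

lemma bottom_switching:
  assumes "layered n gs h" "computes n gs \<phi>" "\<And>i. i < n \<Longrightarrow> dt (set vs) 1 (\<phi> i)" "k < length gs"
  shows "rex (1 / 64) vs (\<lambda>\<rho>. 4 ^ dtdepth (set vs) (restr \<rho> (bottom gs h \<phi> k))) \<le> 2"
proof -
  have lit: "dt (set vs) 1 (\<phi> j)" if "j \<in> gate_args (gs ! k)" "h j = 0" for j
    using assms that by (intro dt_literal[OF assms(1-3)]) (force simp: layered_def)+
  show ?thesis
  proof (cases "gs ! k")
    case (NotG j)
    then show ?thesis using switching_or[of 1 "{}" vs \<phi>] by (simp add: bottom_def)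
  next
    case (AndG js)
    then show ?thesis using switching_and[of 1 "{j\<in>set js. h j = 0}" vs \<phi>] lit by (simp add: bottom_def)
  next
    case (OrG js)
    then show ?thesis using switching_or[of 1 "{j\<in>set js. h j = 0}" vs \<phi>] lit by (simp add: bottom_def)
  qed
qed

text \<open>At height 1 all arguments of an AND or OR gate are literals, so the gate coincides with
  its bottom part.\<close>

lemma shallow_bottom:
  assumes "layered n gs h" "computes n gs \<phi>" "\<And>i. i < n \<Longrightarrow> dt V 1 (\<phi> i)" "w \<ge> 1"
    and bot: "\<And>k. k < length gs \<Longrightarrow> dt V w (bottom gs h \<phi> k)"
  shows "shallow V n gs h w 1 \<phi>"
proof -
  have "dt V w (\<phi> i)" if "i < n + length gs" "h i \<le> 1" for i
    using that
  proof (induction i rule: less_induct)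
    case (less i)
    have k: "i - n < length gs" if "n \<le> i" using that less.prems by simp
    from assms(1,2) less.prems(1) show ?case
    proof (cases rule: node_cases)
      case input
      then show ?thesis using assms(3,4) by (blast intro: dt_mono)
    next
      case (Not j)
      then show ?thesis using less by (auto intro!: dt_not)
    next
      case (And js)
      then have "{j\<in>set js. h j = 0} = set js" using less.prems by fastforce
      then show ?thesis using And bot[OF k] by (simp add: bottom_def)
    next
      case (Or js)
      then have "{j\<in>set js. h j = 0} = set js" using less.prems by fastforce
      then show ?thesis using Or bot[OF k] by (simp add: bottom_def)
    qed
  qed
  then show ?thesis by (auto simp: shallow_def)
qed

text \<open>A gate is a function of its own bottom part and of its arguments of positive height.
  Height 0 is excluded since the bottom parts need not determine a literal.\<close>

lemma node_determined:
  assumes "layered n gs h" "computes n gs \<phi>" "\<And>k. k < length gs \<Longrightarrow> bottom gs h \<phi> k x = bottom gs h \<phi> k y"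
    and "i < n + length gs" "0 < h i"
  shows "\<phi> i x = \<phi> i y"
  using assms(4,5)
proof (induction i rule: less_induct)
  case (less i)
  have k: "i - n < length gs" if "n \<le> i" using that less.prems by simp
  from assms(1,2) less.prems(1) show ?case
  proof (cases rule: node_cases)
    case input
    then show ?thesis using less.prems by simp
  next
    case (Not j)
    then show ?thesis using less by auto
  next
    case (And js)
    have 1: "(\<forall>j\<in>set js. \<phi> j z) \<longleftrightarrow> bottom gs h \<phi> (i - n) z \<and> (\<forall>j\<in>{j\<in>set js. h j > 0}. \<phi> j z)" for z
      using And by (auto simp: bottom_def)
    have "\<phi> j x = \<phi> j y" if "j \<in> {j\<in>set js. h j > 0}" for j
      using that And(5)[of j] less by auto
    then show ?thesis unfolding And(3) 1 using assms(3)[OF k[OF And(1)]] by auto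
  next
    case (Or js)
    have 1: "(\<exists>j\<in>set js. \<phi> j z) \<longleftrightarrow> bottom gs h \<phi> (i - n) z \<or> (\<exists>j\<in>{j\<in>set js. h j > 0}. \<phi> j z)" for z
      using Or by (auto simp: bottom_def)
    have "\<phi> j x = \<phi> j y" if "j \<in> {j\<in>set js. h j > 0}" for j
      using that Or(5)[of j] less by auto
    then show ?thesis unfolding Or(3) 1 using assms(3)[OF k[OF Or(1)]] by auto
  qed
qed

text \<open>The maximum with 1 covers literals; all other nodes are determined by the bottom parts.
  The bound does not involve \<open>n\<close>.\<close>

lemma dt_node:
  assumes "layered n gs h" "computes n gs \<phi>" "\<And>i. i < n \<Longrightarrow> dt V 1 (\<phi> i)"
    and bot: "\<And>k. k < length gs \<Longrightarrow> dt V (t k) (bottom gs h \<phi> k)"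
    and i: "i < n + length gs"
  shows "dt V (max 1 (\<Sum>k<length gs. t k)) (\<phi> i)"
proof (cases "h i = 0")
  case True
  then show ?thesis using dt_literal[OF assms(1-3) i] by (auto elim: dt_mono)
next
  case False
  have "dt V (sum_list (map t [0..<length gs])) (\<phi> i)"
  proof (rule dt_determined[where \<alpha>s = "map (bottom gs h \<phi>) [0..<length gs]"])
    show "list_all2 (dt V) (map t [0..<length gs]) (map (bottom gs h \<phi>) [0..<length gs])"
      using bot by (auto simp: list_all2_conv_all_nth)
  next
    fix x y assume "\<forall>\<alpha>\<in>set (map (bottom gs h \<phi>) [0..<length gs]). \<alpha> x = \<alpha> y"
    then show "\<phi> i x = \<phi> i y"
      by (intro node_determined[OF assms(1,2) _ i]) (use False in auto)
  qed
  then show ?thesis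
    by (rule dt_mono) (simp add: interv_sum_list_conv_sum_set_nat atLeast0LessThan)
qed

lemma square_le_power2: "n \<ge> 4 \<Longrightarrow> (real n)\<^sup>2 \<le> 2 ^ n"
proof (induction n rule: nat_induct_at_least)
  case (Suc n)
  have "(real (Suc n))\<^sup>2 = (real n)\<^sup>2 + (2 * real n + 1)" by (simp add: power2_eq_square algebra_simps)
  also have "2 * real n + 1 \<le> 4 * real n" using Suc.hyps by simp
  also have "4 * real n \<le> (real n)\<^sup>2" using Suc.hyps by (simp add: power2_eq_square)
  finally show ?case using Suc.IH by simp
qed simp

lemma square_le_power4: "(real n)\<^sup>2 \<le> 4 ^ n"
proof -
  have "real n \<le> 2 ^ n" using of_nat_less_two_power[of n] by (simp add: less_imp_le)
  then have "(real n)\<^sup>2 \<le> (2 ^ n)\<^sup>2" by (intro power_mono) auto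
  also have "\<dots> = 4 ^ n" by (simp add: power2_eq_square power_mult_distrib[symmetric])
  finally show ?thesis .
qed

lemma dtdepth_gt: "dt V k f \<Longrightarrow> \<not> dt V w f \<Longrightarrow> w < dtdepth V f"
  using dt_dtdepth dt_mono not_le by blast

text \<open>These existence statements make \<open>dtdepth\<close> a genuine depth for nodes and
  bottom parts.\<close>

lemma dt_determined_exists:
  assumes "\<And>j. j \<in> set js \<Longrightarrow> \<exists>m. dt V m (\<phi> j)"
    and "\<And>x y. (\<forall>j\<in>set js. \<phi> j x = \<phi> j y) \<Longrightarrow> f x = f y"
  shows "\<exists>m. dt V m f"
proof -
  obtain m where m: "\<And>j. j \<in> set js \<Longrightarrow> dt V (m j) (\<phi> j)" using assms(1) by metis
  have "dt V (sum_list (map m js)) f"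
    by (rule dt_determined[where \<alpha>s = "map \<phi> js"])
       (use m assms(2) in \<open>auto simp: list_all2_conv_all_nth\<close>)
  then show ?thesis by blast
qed

lemma node_dt_exists:
  assumes "layered n gs h" "computes n gs \<phi>" "\<And>i. i < n \<Longrightarrow> \<exists>m. dt V m (\<phi> i)" "i < n + length gs"
  shows "\<exists>m. dt V m (\<phi> i)"
  using assms(4)
proof (induction i rule: less_induct)
  case (less i)
  from assms(1,2) less.prems(1) show ?case
  proof (cases rule: node_cases)
    case input
    then show ?thesis using assms(3) by simp
  next
    case (Not j)
    then show ?thesis using less dt_not by (metis less_trans)
  next
    case (And js)
    have "\<exists>m. dt V m (\<phi> j)" if "j \<in> set js" for j
      using less.IH[of j] less.prems that And(5)[of j] by simp
    then show ?thesis
      unfolding And(3) by (rule dt_determined_exists[where js = js and \<phi> = \<phi>]) auto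
  next
    case (Or js)
    have "\<exists>m. dt V m (\<phi> j)" if "j \<in> set js" for j
      using less.IH[of j] less.prems that Or(5)[of j] by simp
    then show ?thesis
      unfolding Or(3) by (rule dt_determined_exists[where js = js and \<phi> = \<phi>]) auto
  qed
qed

lemma bottom_dt_exists:
  assumes "layered n gs h" "computes n gs \<phi>" "\<And>i. i < n \<Longrightarrow> \<exists>m. dt V m (\<phi> i)" "k < length gs"
  shows "\<exists>m. dt V m (bottom gs h \<phi> k)"
proof -
  have *: "\<exists>m. dt V m (\<phi> j)" if "j \<in> gate_args (gs ! k)" for j
  proof -
    have "j < n + k" using that assms(1,4) by (auto simp: layered_def)
    then show ?thesis using assms(4) by (intro node_dt_exists[OF assms(1-3)]) auto
  qed
  show ?thesis
  proof (cases "gs ! k")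
    case (NotG j)
    then show ?thesis by (auto simp: bottom_def intro: dt_const[of _ False])
  next
    case (AndG js)
    show ?thesis
      by (rule dt_determined_exists[where js = js and \<phi> = \<phi>])
         (use * in \<open>auto simp: bottom_def AndG\<close>)
  next
    case (OrG js)
    show ?thesis
      by (rule dt_determined_exists[where js = js and \<phi> = \<phi>])
         (use * in \<open>auto simp: bottom_def OrG\<close>)
  qed
qed

section \<open>Iterated random restrictions of a circuit\<close>

context
  fixes n S w :: nat and gs :: "gate list" and h :: "nat \<Rightarrow> nat" and vs :: "nat list" and p :: real
  assumes layered: "layered n gs h" and size: "length gs \<le> S" and S: "S \<ge> 2"
    and w: "w \<ge> 4" and Sw: "real S ^ 4 \<le> 2 ^ w" and p_def: "p = 1 / (64 * real w)"
begin

lemma p01: "0 < p" "p \<le> 1"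
  using w by (simp_all add: p_def)

lemma S3: "2 * real S ^ 3 \<le> 2 ^ w"
proof -
  have "2 * real S ^ 3 \<le> real S * real S ^ 3" using S by (intro mult_right_mono) auto
  also have "\<dots> = real S ^ 4" by (simp add: power_Suc[symmetric] del: power_Suc)
  finally show ?thesis using Sw by simp
qed

text \<open>Each round makes one further height shallow, and \<open>e\<close> counts the rounds
  after the current one. A failing round falls back on the tree of depth \<open>S * w\<close>, which
  survives restrictions; the last round needs only the expected squared depth.\<close>

lemma rounds:
  assumes "computes n gs \<phi>" "shallow (set vs) n gs h w j \<phi>" "dt (set vs) (S * w) (\<phi> i)"
    and i: "i < n + length gs" and "h i \<le> Suc (j + e)"
  shows "taylor2 vs (\<phi> i) ((2 + real e) / p ^ (2 * Suc e)) (p ^ Suc e)"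
  using assms(1-3,5)
proof (induction e arbitrary: j \<phi>)
  case 0
  let ?D = "\<lambda>\<rho>. dtdepth (set vs) (restr \<rho> (\<phi> i))"
  have "taylor2 vs (restr \<rho> (\<phi> i)) ((real (?D \<rho>))\<^sup>2) 1" for \<rho>
    by (intro dt_taylor2 dt_dtdepth[OF dt_restr[OF 0(3)]])
  from taylor2_restr[OF p01 this]
  have "taylor2 vs (\<phi> i) (rex p vs (\<lambda>\<rho>. (real (?D \<rho>))\<^sup>2) / p\<^sup>2) (p * 1)" .
  moreover have "rex p vs (\<lambda>\<rho>. (real (?D \<rho>))\<^sup>2) \<le> rex p vs (\<lambda>\<rho>. 4 ^ ?D \<rho>)"
    using p01 by (intro rex_mono square_le_power4) auto
  moreover have "rex p vs (\<lambda>\<rho>. 4 ^ ?D \<rho>) \<le> 2"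
    unfolding p_def using w 0 i by (intro node_switching[OF layered]) auto
  ultimately show ?case
    by (elim taylor2_mono) (auto simp: power2_eq_square intro!: divide_right_mono)
next
  case (Suc e)
  let ?V = "set vs"
  let ?\<phi> = "\<lambda>\<rho> l. restr \<rho> (\<phi> l)"
  let ?D = "\<lambda>l \<rho>. dtdepth ?V (restr \<rho> (\<phi> l))"
  let ?A = "{k. k < length gs \<and> h (n + k) \<le> Suc j}"
  define K0 where "K0 = (2 + real e) / p ^ (2 * Suc e)"
  define M where "M = (real (S * w))\<^sup>2"
  define K where "K \<rho> = (if shallow ?V n gs h w (Suc j) (?\<phi> \<rho>) then K0 else M)" for \<rho>
  have "taylor2 vs (restr \<rho> (\<phi> i)) (K \<rho>) (p ^ Suc e)" for \<rho>
  proof (cases "shallow ?V n gs h w (Suc j) (?\<phi> \<rho>)")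
    case True
    then show ?thesis
      using Suc.IH[of "?\<phi> \<rho>" "Suc j"] Suc.prems by (simp add: K_def K0_def computes_restr dt_restr)
  next
    case False
    have "taylor2 vs (restr \<rho> (\<phi> i)) M 1"
      unfolding M_def by (intro dt_taylor2 dt_restr Suc.prems)
    then show ?thesis using False p01 power_le_one[of p "Suc e"] by (auto simp: K_def elim: taylor2_mono)
  qed
  from taylor2_restr[OF p01 this]
  have t: "taylor2 vs (\<phi> i) (rex p vs K / p\<^sup>2) (p * p ^ Suc e)" .
  have K0: "0 \<le> K0" using p01 by (simp add: K0_def)
  \<comment> \<open>Markov's inequality and the union bound, done pointwise: a failing restriction
    leaves some gate with depth above \<open>w\<close>, so the sum is at least 4^w.\<close>
  have "K \<rho> \<le> K0 + M / 4 ^ w * (\<Sum>k\<in>?A. 4 ^ ?D (n + k) \<rho>)" for \<rho>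
  proof (cases "shallow ?V n gs h w (Suc j) (?\<phi> \<rho>)")
    case True
    then show ?thesis by (simp add: K_def M_def sum_nonneg)
  next
    case False
    then obtain l where l: "l < n + length gs" "h l \<le> Suc j" "\<not> dt ?V w (restr \<rho> (\<phi> l))"
      by (auto simp: shallow_def)
    have "\<not> h l \<le> j" using l Suc.prems(2) dt_restr by (auto simp: shallow_def)
    then have "n \<le> l" using layered by (auto simp: layered_def not_less[symmetric])
    then obtain k where k: "l = n + k" using le_Suc_ex by blast
    have "dt ?V w (\<phi> i)" if "i < n" for i
      using that Suc.prems(2) layered by (auto simp: shallow_def layered_def)
    then have "\<exists>m. dt ?V m (\<phi> l)"
      using node_dt_exists[OF layered Suc.prems(1) _ l(1)] by blast
    then have "\<exists>m. dt ?V m (restr \<rho> (\<phi> l))" using dt_restr by blast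
    then obtain m where "dt ?V m (restr \<rho> (\<phi> l))" ..
    then have "w < ?D l \<rho>" using dtdepth_gt l(3) by blast
    then have "(4::real) ^ w \<le> 4 ^ ?D (n + k) \<rho>" unfolding k by (intro power_increasing) auto
    also have "\<dots> \<le> (\<Sum>k\<in>?A. 4 ^ ?D (n + k) \<rho>)"
      using l k by (intro member_le_sum) auto
    finally have "M / 4 ^ w * 4 ^ w \<le> M / 4 ^ w * (\<Sum>k\<in>?A. 4 ^ ?D (n + k) \<rho>)"
      by (intro mult_left_mono) (simp_all add: M_def)
    then show ?thesis using False K0 by (simp add: K_def)
  qed
  then have "rex p vs K \<le> rex p vs (\<lambda>\<rho>. K0 + M / 4 ^ w * (\<Sum>k\<in>?A. 4 ^ ?D (n + k) \<rho>))"
    using p01 by (intro rex_mono) auto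
  also have "\<dots> = K0 + M / 4 ^ w * (\<Sum>k\<in>?A. rex p vs (\<lambda>\<rho>. 4 ^ ?D (n + k) \<rho>))"
    unfolding rex_add rex_mult rex_sum by simp
  also have "\<dots> \<le> K0 + M / 4 ^ w * (\<Sum>k\<in>?A. 2)"
    unfolding p_def using w Suc.prems
    by (intro add_mono order.refl mult_left_mono sum_mono node_switching[OF layered])
       (auto simp: M_def)
  also have "\<dots> \<le> K0 + M / 4 ^ w * (2 * real S)"
  proof -
    have "card ?A \<le> card {..<length gs}" by (intro card_mono) auto
    then show ?thesis using size
      by (intro add_mono order.refl mult_left_mono) (auto simp: M_def)
  qed
  also have "M / 4 ^ w * (2 * real S) = (2 * real S ^ 3) * (real w)\<^sup>2 / 4 ^ w"
    by (simp add: M_def power2_eq_square power3_eq_cube)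
  also have "\<dots> \<le> 2 ^ w * 2 ^ w / 4 ^ w"
    using S3 square_le_power2[OF w] by (intro divide_right_mono mult_mono) auto
  also have "\<dots> = 1" by (simp add: power_mult_distrib[symmetric])
  finally have "rex p vs K \<le> K0 + 1" by simp
  \<comment> \<open>The 1 lost to failures is absorbed by raising the coefficient from 2 + e to 3 +
    e.\<close>
  also have "1 \<le> 1 / p ^ (2 * Suc e)"
    using p01 by (simp add: power_le_one del: power_Suc)
  also have "K0 + 1 / p ^ (2 * Suc e) = (2 + real (Suc e)) / p ^ (2 * Suc e)"
    by (simp add: K0_def add_divide_distrib del: power_Suc)
  finally have "rex p vs K / p\<^sup>2 \<le> (2 + real (Suc e)) / p ^ (2 * Suc e) / p\<^sup>2"
    by (intro divide_right_mono) auto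
  also have "\<dots> = (2 + real (Suc e)) / p ^ (2 * Suc (Suc e))"
    by (simp add: power_add[symmetric] del: power_Suc)
  finally show ?case
    by (intro taylor2_mono[OF t]) auto
qed

text \<open>If all bottom parts become shallow, then so does height 1, and every node gets depth
  \<open>S * w\<close>, as \<open>rounds\<close> requires. Otherwise the fallback depth is the sum
  of the depths of the bottom parts, and exponential moments control its square.\<close>

lemma first_round:
  assumes \<phi>: "computes n gs \<phi>" "\<And>l. l < n \<Longrightarrow> dt (set vs) 1 (\<phi> l)"
    and i: "i < n + length gs" and hi: "h i \<le> 2 + e"
  shows "taylor2 vs (\<phi> i) ((3 + real e) / p ^ (2 * Suc e) * 64\<^sup>2) (p ^ Suc e / 64)"
proof -
  let ?V = "set vs"
  let ?\<phi> = "\<lambda>\<rho> l. restr \<rho> (\<phi> l)"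
  let ?\<alpha> = "bottom gs h \<phi>"
  let ?D = "\<lambda>k \<rho>. dtdepth ?V (restr \<rho> (?\<alpha> k))"
  define K0 where "K0 = (2 + real e) / p ^ (2 * Suc e)"
  define good where "good \<rho> \<longleftrightarrow> (\<forall>k<length gs. ?D k \<rho> \<le> w)" for \<rho>
  define K where "K \<rho> = (if good \<rho> then K0 else (\<Sum>k<length gs. real (?D k \<rho>))\<^sup>2)" for \<rho>
  have comp: "computes n gs (?\<phi> \<rho>)" for \<rho> by (rule computes_restr[OF \<phi>(1)])
  have inp: "dt ?V 1 (?\<phi> \<rho> l)" if "l < n" for l \<rho> by (rule dt_restr[OF \<phi>(2)[OF that]])
  have bot: "dt ?V (?D k \<rho>) (bottom gs h (?\<phi> \<rho>) k)" if k: "k < length gs" for k \<rho>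
  proof -
    have "\<exists>m. dt ?V m (\<phi> l)" if "l < n" for l using \<phi>(2)[OF that] by blast
    then obtain m where "dt ?V m (?\<alpha> k)" using bottom_dt_exists[OF layered \<phi>(1) _ k] by blast
    then show ?thesis unfolding bottom_restr by (rule dt_dtdepth[OF dt_restr])
  qed
  have "taylor2 vs (restr \<rho> (\<phi> i)) (K \<rho>) (p ^ Suc e)" for \<rho>
  proof (cases "good \<rho>")
    case True
    then have b: "dt ?V w (bottom gs h (?\<phi> \<rho>) k)" if "k < length gs" for k
      using bot[OF that, of \<rho>] that unfolding good_def by (blast intro: dt_mono)
    have sh: "shallow ?V n gs h w 1 (?\<phi> \<rho>)"
      using w by (intro shallow_bottom[OF layered comp inp _ b]) auto
    have "max 1 (\<Sum>k<length gs. w) \<le> S * w"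
      using size S w by simp
    with dt_node[OF layered comp inp b i] have "dt ?V (S * w) (restr \<rho> (\<phi> i))"
      by (rule dt_mono)
    from rounds[OF comp sh this i, of e] hi show ?thesis
      using True by (simp add: K_def K0_def)
  next
    case False
    then obtain k where k: "k < length gs" "w < ?D k \<rho>" by (auto simp: good_def)
    have "?D k \<rho> \<le> (\<Sum>k<length gs. ?D k \<rho>)" using k by (intro member_le_sum) auto
    then have "max 1 (\<Sum>k<length gs. ?D k \<rho>) = (\<Sum>k<length gs. ?D k \<rho>)" using k by simp
    then have "dt ?V (\<Sum>k<length gs. ?D k \<rho>) (restr \<rho> (\<phi> i))"
      using dt_node[OF layered comp inp bot i, of \<rho>] by simp
    then have "taylor2 vs (restr \<rho> (\<phi> i)) (K \<rho>) 1"
      using dt_taylor2[of vs "\<Sum>k<length gs. ?D k \<rho>"] False by (simp add: K_def)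
    then show ?thesis using p01 power_le_one[of p "Suc e"] by (auto elim: taylor2_mono)
  qed
  then have "taylor2 vs (\<phi> i) (rex (1 / 64) vs K / (1 / 64)\<^sup>2) (1 / 64 * p ^ Suc e)"
    by (intro taylor2_restr) auto
  then have t: "taylor2 vs (\<phi> i) (rex (1 / 64) vs K * 64\<^sup>2) (p ^ Suc e / 64)"
    by (simp add: power_divide)
  have K0: "0 \<le> K0" using p01 by (simp add: K0_def)
  have "K \<rho> \<le> K0 + (real S)\<^sup>2 / 2 ^ w * (\<Sum>k<length gs. 4 ^ ?D k \<rho>)" for \<rho>
  proof (cases "good \<rho>")
    case True
    then show ?thesis by (simp add: K_def sum_nonneg)
  next
    case False
    then obtain k where k: "k < length gs" "w < ?D k \<rho>" by (auto simp: good_def)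
    \<comment> \<open>The largest depth m exceeds w >= 4, so m^2 <= 2^m and 2^w <= 2^m. Hence m^2 <=
      4^m / 2^w, which turns the square into the moment and gains 2^w.\<close>
    define m where "m = Max ((\<lambda>k. ?D k \<rho>) ` {..<length gs})"
    have le: "?D k \<rho> \<le> m" if "k < length gs" for k unfolding m_def using that by (intro Max_ge) auto
    have "m \<in> (\<lambda>k. ?D k \<rho>) ` {..<length gs}" unfolding m_def using k by (intro Max_in) auto
    then obtain l where l: "l < length gs" "m = ?D l \<rho>" by auto
    have wm: "w < m" using k le[OF k(1)] by simp
    have "(\<Sum>k<length gs. real (?D k \<rho>)) \<le> (\<Sum>k<length gs. real m)"
      using le by (intro sum_mono) auto
    also have "\<dots> \<le> real S * real m" using size by (simp add: mult_right_mono)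
    finally have "(\<Sum>k<length gs. real (?D k \<rho>))\<^sup>2 \<le> (real S * real m)\<^sup>2"
      by (intro power_mono sum_nonneg) auto
    also have "\<dots> = (real S)\<^sup>2 * (real m)\<^sup>2" by (simp add: power_mult_distrib)
    also have "\<dots> \<le> (real S)\<^sup>2 * (4 ^ m / 2 ^ w)"
    proof (intro mult_left_mono)
      have "(real m)\<^sup>2 * 2 ^ w \<le> 2 ^ m * 2 ^ m"
        using wm w by (intro mult_mono square_le_power2 power_increasing) auto
      also have "\<dots> = 4 ^ m" by (simp add: power_mult_distrib[symmetric])
      finally show "(real m)\<^sup>2 \<le> 4 ^ m / 2 ^ w" by (simp add: field_simps)
    qed simp
    also have "\<dots> = (real S)\<^sup>2 / 2 ^ w * 4 ^ ?D l \<rho>" by (simp add: l)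
    also have "\<dots> \<le> (real S)\<^sup>2 / 2 ^ w * (\<Sum>k<length gs. 4 ^ ?D k \<rho>)"
      using l(1) by (intro mult_left_mono member_le_sum) auto
    finally show ?thesis using False K0 by (simp add: K_def)
  qed
  then have "rex (1 / 64) vs K \<le> rex (1 / 64) vs (\<lambda>\<rho>. K0 + (real S)\<^sup>2 / 2 ^ w * (\<Sum>k<length gs. 4 ^ ?D k \<rho>))"
    by (intro rex_mono) auto
  also have "\<dots> = K0 + (real S)\<^sup>2 / 2 ^ w * (\<Sum>k<length gs. rex (1 / 64) vs (\<lambda>\<rho>. 4 ^ ?D k \<rho>))"
    unfolding rex_add rex_mult rex_sum by simp
  also have "\<dots> \<le> K0 + (real S)\<^sup>2 / 2 ^ w * (\<Sum>k<length gs. 2)"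
    by (intro add_mono order.refl mult_left_mono sum_mono bottom_switching[OF layered \<phi>]) auto
  also have "\<dots> \<le> K0 + (real S)\<^sup>2 / 2 ^ w * (2 * real S)"
    using size by (intro add_mono order.refl mult_left_mono) auto
  also have "(real S)\<^sup>2 / 2 ^ w * (2 * real S) = (2 * real S ^ 3) / 2 ^ w"
    by (simp add: power2_eq_square power3_eq_cube)
  also have "\<dots> \<le> 1" using S3 by simp
  finally have "rex (1 / 64) vs K \<le> K0 + 1" by simp
  also have "1 \<le> 1 / p ^ (2 * Suc e)"
    using p01 by (simp add: power_le_one del: power_Suc)
  also have "K0 + 1 / p ^ (2 * Suc e) = (3 + real e) / p ^ (2 * Suc e)"
    by (simp add: K0_def add_divide_distrib[symmetric] del: power_Suc)
  finally show ?thesis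
    by (intro taylor2_mono[OF t] mult_right_mono) auto
qed

end

section \<open>Circuit evaluation and circuit depth as one fold over the gates\<close>

definition build :: "('b list \<Rightarrow> gate \<Rightarrow> 'b) \<Rightarrow> 'b list \<Rightarrow> gate list \<Rightarrow> 'b list" where
  "build F x gs = foldl (\<lambda>v g. v @ [F v g]) x gs"

lemma build_snoc: "build F x (gs @ [g]) = build F x gs @ [F (build F x gs) g]"
  by (simp add: build_def)

lemma length_build: "length (build F x gs) = length x + length gs"
proof (induction gs rule: rev_induct)
  case Nil
  then show ?case by (simp add: build_def)
qed (simp add: build_snoc)

text \<open>Gates only append, so an entry never changes once written; a gate may then be read on
  the final list instead of its prefix.\<close>

lemma build_take:
  "i < length x + k \<Longrightarrow> k \<le> length gs \<Longrightarrow> build F x gs ! i = build F x (take k gs) ! i"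
proof (induction gs rule: rev_induct)
  case (snoc g gs)
  then show ?case
    by (cases "k = length (gs @ [g])") (auto simp: build_snoc nth_append length_build)
qed simp

lemma nth_build_input: "i < length x \<Longrightarrow> build F x gs ! i = x ! i"
  using build_take[of i x 0 gs F] by (simp add: build_def)

lemma nth_build_gate:
  assumes "k < length gs" shows "build F x gs ! (length x + k) = F (build F x (take k gs)) (gs ! k)"
proof -
  have "build F x gs ! (length x + k) = build F x (take (Suc k) gs) ! (length x + k)"
    using assms by (intro build_take) auto
  also have "take (Suc k) gs = take k gs @ [gs ! k]"
    using assms by (simp add: take_Suc_conv_app_nth)
  finally show ?thesis using assms by (simp add: build_snoc nth_append length_build)
qed

lemma gate_value_cong:
  "gate_args g \<subseteq> {..<m} \<Longrightarrow> (\<And>i. i < m \<Longrightarrow> v ! i = v' ! i) \<Longrightarrow> gate_value v g = gate_value v' g"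
  by (cases g) auto

lemma gate_depth_cong:
  assumes "gate_args g \<subseteq> {..<m}" "\<And>i. i < m \<Longrightarrow> v ! i = v' ! i"
  shows "gate_depth v g = gate_depth v' g"
proof (cases g)
  case (AndG js)
  then have "(\<lambda>i. v ! i) ` set js = (\<lambda>i. v' ! i) ` set js"
    using assms by (intro image_cong) auto
  then show ?thesis using AndG by simp
next
  case (OrG js)
  then have "(\<lambda>i. v ! i) ` set js = (\<lambda>i. v' ! i) ` set js"
    using assms by (intro image_cong) auto
  then show ?thesis using OrG by simp
qed (use assms in auto)

lemma circuit_layered:
  assumes "wf_circuit n c"
  shows "layered n (gates c) (\<lambda>i. build gate_depth (replicate n 0) (gates c) ! i)"
proof -
  let ?h = "build gate_depth (replicate n 0) (gates c)"
  have args: "gate_args (gates c ! k) \<subseteq> {..<n + k}" if "k < length (gates c)" for k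
    using assms that by (auto simp: wf_circuit_def)
  have step: "?h ! (n + k) = gate_depth ?h (gates c ! k)" if k: "k < length (gates c)" for k
  proof -
    have "?h ! (n + k) = gate_depth (build gate_depth (replicate n 0) (take k (gates c))) (gates c ! k)"
      using nth_build_gate[OF k, of gate_depth "replicate n 0"] by simp
    also have "\<dots> = gate_depth ?h (gates c ! k)"
      using k by (intro gate_depth_cong[OF args[OF k]] build_take[symmetric]) auto
    finally show ?thesis .
  qed
  have "?h ! i = 0" if "i < n" for i
    using that by (simp add: nth_build_input)
  moreover have "case gates c ! k of NotG j \<Rightarrow> ?h ! (n + k) = ?h ! j
      | AndG js \<Rightarrow> 0 < ?h ! (n + k) \<and> (\<forall>j\<in>set js. ?h ! j < ?h ! (n + k))
      | OrG js \<Rightarrow> 0 < ?h ! (n + k) \<and> (\<forall>j\<in>set js. ?h ! j < ?h ! (n + k))"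
    if k: "k < length (gates c)" for k
    using step[OF k] by (auto split: gate.splits simp: less_Suc_eq_le intro!: Max_ge)
  ultimately show ?thesis using args by (simp add: layered_def)
qed

lemma circuit_computes:
  assumes "wf_circuit n c"
  shows "computes n (gates c) (\<lambda>i x. build gate_value (map x [0..<n]) (gates c) ! i)"
proof -
  have "build gate_value (map x [0..<n]) (gates c) ! (n + k) =
      gate_value (build gate_value (map x [0..<n]) (gates c)) (gates c ! k)"
    if k: "k < length (gates c)" for k and x :: "nat \<Rightarrow> bool"
  proof -
    let ?x = "map x [0..<n]"
    have args: "gate_args (gates c ! k) \<subseteq> {..<n + k}"
      using assms k by (auto simp: wf_circuit_def)
    have "build gate_value ?x (gates c) ! (n + k) =
        gate_value (build gate_value ?x (take k (gates c))) (gates c ! k)"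
      using nth_build_gate[OF k, of gate_value ?x] by simp
    also have "\<dots> = gate_value (build gate_value ?x (gates c)) (gates c ! k)"
      using k by (intro gate_value_cong[OF args] build_take[symmetric]) auto
    finally show ?thesis .
  qed
  then show ?thesis
    unfolding computes_def by (auto split: gate.splits)
qed

text \<open>Here 61440 = 128 * 480: 480 ln S bounds 64 w in \<open>width_exists\<close>, and 128 = 2
  * 64 absorbs the 64 of the first round and the square root of 3 + e, see
  \<open>power4_ge\<close>.\<close>

definition slope_bound :: "nat \<Rightarrow> nat \<Rightarrow> real" where
  "slope_bound S d = (61440 * ln (real S)) ^ (d - 1)"

lemma width_exists:
  assumes "S \<ge> 2"
  obtains w :: nat where "w \<ge> 4" "real S ^ 4 \<le> 2 ^ w" "64 * real w \<le> 480 * ln (real S)"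
proof -
  define l where "l = log 2 (real S)"
  have l: "l \<ge> 1" using assms by (simp add: l_def le_log_iff)
  \<comment> \<open>Since l >= 1 and ln S >= 2 l / 3, this gives 64 w <= 320 l <= 480 ln S.\<close>
  define w where "w = nat \<lceil>4 * l\<rceil>"
  have w: "4 * l \<le> real w" "real w \<le> 4 * l + 1"
    using l by (auto simp: w_def)
  have "2 powr l = real S" using assms by (simp add: l_def)
  then have "real S ^ 4 = (2 powr l) powr 4" using assms by (simp add: powr_numeral)
  also have "\<dots> = 2 powr (4 * l)" by (simp add: powr_powr mult.commute)
  also have "\<dots> \<le> 2 powr real w" using w by (intro powr_mono) auto
  finally have "real S ^ 4 \<le> 2 ^ w" by (simp add: powr_realpow)
  moreover have "w \<ge> 4" using w l by linarith
  moreover have "64 * real w \<le> 480 * ln (real S)"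
  proof -
    have "2 / 3 * l \<le> ln 2 * l" using l ln2_ge_two_thirds by (intro mult_right_mono) auto
    also have "ln 2 * l = ln (real S)" by (simp add: l_def log_def)
    finally show ?thesis using w l by simp
  qed
  ultimately show ?thesis using that by blast
qed

lemma power4_ge: "3 + real e \<le> 4 ^ Suc e"
  by (induction e) auto

text \<open>Tal's bounds for the first two Fourier levels of a bounded-depth circuit, in integrated form.\<close>

lemma circuit_taylor2:
  assumes f: "f \<in> circuit_class n S d" and S: "S \<ge> 2" and d: "d \<ge> 2"
  shows "taylor2 [0..<n] (\<lambda>x. f (map x [0..<n])) ((slope_bound S d)\<^sup>2) (1 / slope_bound S d)"
proof -
  obtain c where c: "wf_circuit n c" "circuit_size c \<le> S" "circuit_depth n c \<le> d"
    "\<And>x. x \<in> cube n \<Longrightarrow> f x = circuit_value c x"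
    using f by (auto simp: circuit_class_def)
  obtain w where w: "w \<ge> 4" "real S ^ 4 \<le> 2 ^ w" "64 * real w \<le> 480 * ln (real S)"
    using width_exists[OF S] .
  have pw: "(64 * real w) ^ m \<le> (480 * ln (real S)) ^ m" for m
    by (rule power_mono[OF w(3)]) simp
  have ln0: "0 \<le> ln (real S)" using S by simp
  define p where "p = 1 / (64 * real w)"
  \<comment> \<open>The first round handles height 1; the other e + 1 = d - 1 rounds, with survival
    probability p, handle one further height each.\<close>
  define e where "e = d - 2"
  have d': "d = 2 + e" using d by (simp add: e_def)
  let ?\<phi> = "\<lambda>i x. build gate_value (map x [0..<n]) (gates c) ! i"
  let ?h = "\<lambda>i. build gate_depth (replicate n 0) (gates c) ! i"
  have inp: "dt (set [0..<n]) 1 (?\<phi> l)" if "l < n" for l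
  proof -
    have "dt (set [0..<n]) (card {l}) (?\<phi> l)"
      using that by (intro dt_finite_support) (auto simp: nth_build_input)
    then show ?thesis by simp
  qed
  have "taylor2 [0..<n] (?\<phi> (out_node c)) ((3 + real e) / p ^ (2 * Suc e) * 64\<^sup>2) (p ^ Suc e / 64)"
  proof (rule first_round[OF circuit_layered[OF c(1)]])
    show "length (gates c) \<le> S" using c(2) by (simp add: circuit_size_def)
    show "out_node c < n + length (gates c)" using c(1) by (simp add: wf_circuit_def)
    show "?h (out_node c) \<le> 2 + e" using c(3) d' by (simp add: circuit_depth_def build_def)
  qed (use S w p_def circuit_computes[OF c(1)] inp in auto)
  moreover have "?\<phi> (out_node c) = (\<lambda>x. f (map x [0..<n]))"
    using c(4) by (simp add: circuit_value_def build_def cube_def)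
  moreover have "(3 + real e) / p ^ (2 * Suc e) * 64\<^sup>2 \<le> (slope_bound S d)\<^sup>2"
  proof -
    have "(3 + real e) / p ^ (2 * Suc e) * 64\<^sup>2 = (3 + real e) * (64 * real w) ^ (2 * Suc e) * 64\<^sup>2"
      by (simp add: p_def power_divide)
    also have "\<dots> \<le> 4 ^ Suc e * (480 * ln (real S)) ^ (2 * Suc e) * (64\<^sup>2) ^ Suc e"
    proof (intro mult_mono power4_ge pw)
      show "(64::real)\<^sup>2 \<le> (64\<^sup>2) ^ Suc e" using power_increasing[of 1 "Suc e" "(64::real)\<^sup>2"] by simp
    qed (use ln0 in auto)
    also have "\<dots> = (128 * (480 * ln (real S))) ^ (2 * Suc e)"
      unfolding power_mult power_mult_distrib[symmetric] by (simp add: power_mult_distrib)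
    also have "\<dots> = (slope_bound S d)\<^sup>2"
    proof -
      have "2 * Suc e = (d - 1) * 2" by (simp add: d')
      then show ?thesis unfolding slope_bound_def power_mult[symmetric] by simp
    qed
    finally show ?thesis .
  qed
  moreover have "1 / slope_bound S d \<le> p ^ Suc e / 64"
  proof -
    have p: "p ^ Suc e / 64 = 1 / (64 * (64 * real w) ^ Suc e)"
      by (simp add: p_def power_divide)
    have "64 * (64 * real w) ^ Suc e \<le> 128 ^ Suc e * (480 * ln (real S)) ^ Suc e"
    proof (intro mult_mono pw)
      show "(64::real) \<le> 128 ^ Suc e" 
      proof -
        have "(1::real) \<le> 128 ^ e" by (rule one_le_power) simp
        then show ?thesis unfolding power_Suc by linarith
      qed
    qed (use ln0 in auto)
    also have "\<dots> = slope_bound S d"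
      unfolding slope_bound_def power_mult_distrib[symmetric] by (simp add: d' del: power_Suc)
    finally show ?thesis
      unfolding p using w(1) by (intro frac_le) simp_all
  qed
  ultimately show ?thesis by (auto intro: taylor2_mono)
qed

text \<open>This keeps 1 / B a legitimate bias, and it is how the hypothesis on \<open>S\<close>
  comes to bound \<epsilon> in the final proof.\<close>

lemma slope_bound_ge_1:
  assumes "S \<ge> 2" shows "slope_bound S d \<ge> 1"
proof -
  have "ln (real S) \<ge> ln 2" using assms by simp
  then have "ln (real S) \<ge> 2 / 3" using ln2_ge_two_thirds by linarith
  then show ?thesis unfolding slope_bound_def by (intro one_le_power) simp
qed

section \<open>Biased bits and dense distributions\<close>

definition biased :: "nat \<Rightarrow> real \<Rightarrow> bool list pmf" where
  "biased n \<theta> = replicate_pmf n (bernoulli_pmf ((1 + \<theta>) / 2))"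

lemma finite_cube [simp]: "finite (cube n)"
  using finite_lists_length_eq[of "UNIV :: bool set" n] by (simp add: cube_def)

lemma card_cube: "card (cube n) = 2 ^ n"
  using card_lists_length_eq[of "UNIV :: bool set" n] by (simp add: cube_def)

lemma cube_nonempty [simp]: "cube n \<noteq> {}"
  using card_cube[of n] by force

lemma over_cube_biased: "over_cube n (biased n \<theta>)"
  by (auto simp: over_cube_def biased_def set_replicate_pmf cube_def)

lemma over_cube_finite: "over_cube n X \<Longrightarrow> finite (set_pmf X)"
  unfolding over_cube_def using finite_cube finite_subset by blast

text \<open>The offset \<open>k\<close> is there because \<open>replicate_pmf\<close> grows at the
  front and shifts the indices of the other bits.\<close>

lemma expectation_biased:
  assumes "\<bar>\<theta>\<bar> \<le> 1"
  shows "measure_pmf.expectation (biased n \<theta>) \<Psi> = bex \<theta> [k..<k + n] (\<lambda>x. \<Psi> (map x [k..<k + n]))"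
proof (induction n arbitrary: k \<Psi>)
  case 0
  then show ?case by (simp add: biased_def)
next
  case (Suc n)
  let ?r = "(1 + \<theta>) / 2"
  have r: "0 \<le> ?r" "?r \<le> 1" using assms by auto
  have fin: "finite (set_pmf (replicate_pmf n (bernoulli_pmf ?r)))"
    using over_cube_finite[OF over_cube_biased] by (simp add: biased_def)
  have eq: "biased (Suc n) \<theta> = bernoulli_pmf ?r \<bind> (\<lambda>b. map_pmf ((#) b) (biased n \<theta>))"
    by (simp add: biased_def map_pmf_def)
  have "measure_pmf.expectation (biased (Suc n) \<theta>) \<Psi> =
     ?r * measure_pmf.expectation (biased n \<theta>) (\<lambda>x. \<Psi> (True # x)) +
     (1 - ?r) * measure_pmf.expectation (biased n \<theta>) (\<lambda>x. \<Psi> (False # x))"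
    unfolding eq using fin r
    by (subst pmf_expectation_bind[of UNIV]) (auto simp: biased_def UNIV_bool)
  also have "\<dots> = bex \<theta> [k..<k + Suc n] (\<lambda>x. \<Psi> (map x [k..<k + Suc n]))"
  proof -
    have upt: "[k..<k + Suc n] = k # [Suc k..<Suc k + n]" by (simp add: upt_conv_Cons)
    have mp: "map (x(k := b)) [Suc k..<Suc k + n] = map x [Suc k..<Suc k + n]" for x :: "nat \<Rightarrow> bool" and b
      by simp
    have "1 - ?r = (1 - \<theta>) / 2" by (simp add: field_simps)
    then show ?thesis
      unfolding upt by (simp add: Suc.IH[of _ "Suc k"] mp del: upt_Suc)
  qed
  finally show ?case .
qed

lemma expect_biased:
  assumes "\<bar>\<theta>\<bar> \<le> 1"
  shows "expect f (biased n \<theta>) = bex \<theta> [0..<n] (\<lambda>x. of_bool (f (map x [0..<n])))"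
  using expectation_biased[OF assms, of n _ 0] by (simp add: expect_def)

lemma pmf_biased_0: "length xs = n \<Longrightarrow> pmf (biased n 0) xs = 1 / 2 ^ n"
proof (induction n arbitrary: xs)
  case 0
  then show ?case by (simp add: biased_def)
next
  case (Suc n)
  then obtain b ys where xs: "xs = b # ys" "length ys = n" by (cases xs) auto
  have eq: "biased (Suc n) 0 = bernoulli_pmf (1 / 2) \<bind> (\<lambda>b. map_pmf ((#) b) (biased n 0))"
    by (simp add: biased_def map_pmf_def)
  have pc: "pmf (map_pmf ((#) c) (biased n 0)) xs = of_bool (c = b) * (1 / 2 ^ n)" for c
  proof (cases "c = b")
    case True
    then show ?thesis using Suc.IH[OF xs(2)] pmf_map_inj'[of "(#) b" "biased n 0" ys] by (simp add: xs)
  next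
    case False
    then have "xs \<notin> set_pmf (map_pmf ((#) c) (biased n 0))" by (auto simp: xs)
    then have "pmf (map_pmf ((#) c) (biased n 0)) xs = 0" by (simp only: set_pmf_iff not_not)
    then show ?thesis using False by simp
  qed
  show ?case
    unfolding eq pmf_bind pc by (subst integral_bernoulli_pmf) (cases b; simp)+
qed

lemma uniform_eq_biased: "uniform n = biased n 0"
proof (rule pmf_eqI)
  fix xs
  show "pmf (uniform n) xs = pmf (biased n 0) xs"
  proof (cases "xs \<in> cube n")
    case True
    then show ?thesis
      using pmf_biased_0[of xs n] by (simp add: uniform_def pmf_of_set cube_def[symmetric] card_cube) (simp add: cube_def)
  next
    case False
    then have "xs \<notin> set_pmf (biased n 0)" using over_cube_biased[of n 0] by (auto simp: over_cube_def)
    then have "pmf (biased n 0) xs = 0" by (simp add: set_pmf_iff)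
    then show ?thesis using False by (simp add: uniform_def)
  qed
qed

section \<open>Mixtures and coordinate tests\<close>

definition mixture :: "real \<Rightarrow> 'a pmf \<Rightarrow> 'a pmf \<Rightarrow> 'a pmf" where
  "mixture r X Y = bernoulli_pmf r \<bind> (\<lambda>b. if b then X else Y)"

lemma pmf_mixture: "0 \<le> r \<Longrightarrow> r \<le> 1 \<Longrightarrow> pmf (mixture r X Y) z = r * pmf X z + (1 - r) * pmf Y z"
  unfolding mixture_def pmf_bind by (subst integral_bernoulli_pmf) auto

lemma over_cube_mixture: "over_cube n X \<Longrightarrow> over_cube n Y \<Longrightarrow> over_cube n (mixture r X Y)"
  by (auto simp: over_cube_def mixture_def set_bind_pmf split: if_splits)

lemma expectation_cube:
  "over_cube n X \<Longrightarrow> measure_pmf.expectation X \<Psi> = (\<Sum>z\<in>cube n. pmf X z * \<Psi> z)"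
  by (subst integral_measure_pmf[of "cube n"]) (auto simp: over_cube_def set_pmf_iff)

lemma expect_mixture:
  assumes "over_cube n X" "over_cube n Y" "0 \<le> r" "r \<le> 1"
  shows "expect f (mixture r X Y) = r * expect f X + (1 - r) * expect f Y"
  unfolding expect_def expectation_cube[OF assms(1)] expectation_cube[OF assms(2)]
    expectation_cube[OF over_cube_mixture[OF assms(1,2)]]
  unfolding pmf_mixture[OF assms(3,4)] sum_distrib_left sum.distrib[symmetric]
  by (intro sum.cong refl) (simp only: distrib_right mult.assoc)

text \<open>The circuit without gates has size 0 and depth 0, whatever \<open>S\<close> and
  \<open>d\<close> are.\<close>

lemma coordinate_in_class: "i < n \<Longrightarrow> (\<lambda>x. x ! i) \<in> circuit_class n S d"
  unfolding circuit_class_def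
  by (intro CollectI exI[of _ "Circuit [] i"])
     (auto simp: wf_circuit_def circuit_size_def circuit_depth_def circuit_value_def)

lemma expect_coordinate_biased:
  assumes "\<bar>\<theta>\<bar> \<le> 1" "i < n"
  shows "expect (\<lambda>x. x ! i) (biased n \<theta>) = (1 + \<theta>) / 2"
proof -
  have "expect (\<lambda>x. x ! i) (biased n \<theta>) = bex \<theta> [0..<n] (\<lambda>x. of_bool (x i))"
    using assms by (simp add: expect_biased)
  also have "\<dots> = (1 + \<theta>) / 2"
    using assms(2) by (subst bex_resample[of i]) auto
  finally show ?thesis .
qed

section \<open>Exponential moments and dense distributions\<close>

definition signed_sum :: "bool list \<Rightarrow> real" where
  "signed_sum xs = (\<Sum>i<length xs. 2 * of_bool (xs ! i) - 1)"

lemma signed_sum_Cons: "signed_sum (b # xs) = (2 * of_bool b - 1) + signed_sum xs"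
  unfolding signed_sum_def by (simp add: sum.lessThan_Suc_shift del: sum.lessThan_Suc)

lemma exp_moment_uniform:
  assumes "0 \<le> l" "l \<le> 1"
  shows "measure_pmf.expectation (biased n 0) (\<lambda>z. exp (l * signed_sum z)) \<le> exp (real n * l\<^sup>2)"
proof -
  have pos: "exp l \<le> 1 + l + l\<^sup>2" using exp_bound assms by blast
  have neg: "exp (- l) \<le> 1 - l + l\<^sup>2"
  proof -
    have "(1 - l + l\<^sup>2) * exp l \<ge> (1 - l + l\<^sup>2) * (1 + l)"
      using assms exp_ge_add_one_self[of l] by (intro mult_left_mono) auto
    also have "(1 - l + l\<^sup>2) * (1 + l) = 1 + l ^ 3" by (simp add: power2_eq_square power3_eq_cube algebra_simps)
    finally have "(1 - l + l\<^sup>2) * exp l \<ge> 1" using assms zero_le_power[of l 3] by linarith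
    then show ?thesis by (simp add: exp_minus field_simps)
  qed
  have step: "(exp l + exp (- l)) / 2 \<le> exp (l\<^sup>2)"
  proof -
    have "1 + l\<^sup>2 \<le> exp (l\<^sup>2)" by (rule exp_ge_add_one_self)
    then have "exp l + exp (- l) \<le> 2 * exp (l\<^sup>2)" using pos neg by argo
    then show ?thesis by simp
  qed
  have "measure_pmf.expectation (biased n 0) (\<lambda>z. exp (l * signed_sum z)) = ((exp l + exp (- l)) / 2) ^ n"
  proof -
    \<comment> \<open>The factor \<open>c\<close> collects the contribution of the bits already
      processed.\<close>
    have "bex 0 [k..<k + n] (\<lambda>x. c * exp (l * signed_sum (map x [k..<k + n]))) = c * ((exp l + exp (- l)) / 2) ^ n" for k c
    proof (induction n arbitrary: k c)
      case 0
      then show ?case by (simp add: signed_sum_def)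
    next
      case (Suc n)
      have upt: "[k..<k + Suc n] = k # [Suc k..<Suc k + n]" by (simp add: upt_conv_Cons)
      have mp: "map (x(k := b)) [Suc k..<Suc k + n] = map x [Suc k..<Suc k + n]" for x :: "nat \<Rightarrow> bool" and b
        by simp
      have e: "c * exp (l * (a + s)) = (c * exp (l * a)) * exp (l * s)" for a s
        by (simp add: distrib_left exp_add)
      show ?case
        unfolding upt bex.simps list.map mp fun_upd_same signed_sum_Cons e Suc.IH
        by (simp add: field_simps)
    qed
    from this[of 0 1] show ?thesis by (subst expectation_biased[of _ _ _ 0]) simp_all
  qed
  also have "\<dots> \<le> exp (l\<^sup>2) ^ n" using step by (intro power_mono) auto
  also have "\<dots> = exp (real n * l\<^sup>2)" by (simp add: exp_of_nat_mult)
  finally show ?thesis .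
qed

text \<open>Jensen's inequality, via the tangent of exp at l \<mu>, bounds exp (l \<mu>) by the
  exponential moment under M. Density transfers this to the uniform distribution at the price of 1 /
  \<delta>.\<close>

lemma dense_signed_sum:
  assumes M: "over_cube n M" "dense_in \<delta> M (uniform n)" and \<delta>: "0 < \<delta>" and l: "0 < l" "l \<le> 1"
  shows "measure_pmf.expectation M signed_sum \<le> ln (1 / \<delta>) / l + real n * l"
proof -
  define \<mu> where "\<mu> = measure_pmf.expectation M signed_sum"
  note EM = expectation_cube[OF M(1)]
  have one: "(\<Sum>z\<in>cube n. pmf M z) = 1" using EM[of "\<lambda>_. 1"] by simp
  have "exp (l * \<mu>) = (\<Sum>z\<in>cube n. pmf M z * (exp (l * \<mu>) * (1 + (l * signed_sum z - l * \<mu>))))"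
  proof -
    have "(\<Sum>z\<in>cube n. pmf M z * (exp (l * \<mu>) * (1 + (l * signed_sum z - l * \<mu>)))) =
       (\<Sum>z\<in>cube n. exp (l * \<mu>) * (1 - l * \<mu>) * pmf M z + exp (l * \<mu>) * l * (pmf M z * signed_sum z))"
      by (intro sum.cong refl) (simp add: algebra_simps)
    also have "\<dots> = exp (l * \<mu>) * (1 - l * \<mu>) * (\<Sum>z\<in>cube n. pmf M z)
        + exp (l * \<mu>) * l * (\<Sum>z\<in>cube n. pmf M z * signed_sum z)"
      by (simp add: sum.distrib sum_distrib_left)
    also have "\<dots> = exp (l * \<mu>) * (1 - l * \<mu>) + exp (l * \<mu>) * l * \<mu>"
      using one EM[of signed_sum] by (simp add: \<mu>_def)
    finally show ?thesis by (simp add: algebra_simps)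
  qed
  also have "\<dots> \<le> (\<Sum>z\<in>cube n. (pmf (uniform n) z / \<delta>) * exp (l * signed_sum z))"
  proof (intro sum_mono)
    fix z
    have "exp (l * \<mu>) * (1 + (l * signed_sum z - l * \<mu>)) \<le> exp (l * \<mu>) * exp (l * signed_sum z - l * \<mu>)"
      by (intro mult_left_mono exp_ge_add_one_self) auto
    then have "exp (l * \<mu>) * (1 + (l * signed_sum z - l * \<mu>)) \<le> exp (l * signed_sum z)"
      by (simp add: exp_add[symmetric])
    then have "pmf M z * (exp (l * \<mu>) * (1 + (l * signed_sum z - l * \<mu>))) \<le> pmf M z * exp (l * signed_sum z)"
      by (intro mult_left_mono) auto
    also have "pmf M z \<le> pmf (uniform n) z / \<delta>"
      using M(2) \<delta> by (simp add: dense_in_def field_simps)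
    finally show "pmf M z * (exp (l * \<mu>) * (1 + (l * signed_sum z - l * \<mu>)))
        \<le> (pmf (uniform n) z / \<delta>) * exp (l * signed_sum z)" by (simp add: mult_right_mono)
  qed
  also have "\<dots> = (1 / \<delta>) * measure_pmf.expectation (biased n 0) (\<lambda>z. exp (l * signed_sum z))"
    unfolding expectation_cube[OF over_cube_biased] uniform_eq_biased
    by (simp add: sum_distrib_left)
  also have "\<dots> \<le> (1 / \<delta>) * exp (real n * l\<^sup>2)"
    using \<delta> l by (intro mult_left_mono exp_moment_uniform) auto
  also have "\<dots> = exp (ln (1 / \<delta>) + real n * l\<^sup>2)" using \<delta> by (simp add: exp_add)
  finally have "l * \<mu> \<le> ln (1 / \<delta>) + real n * l\<^sup>2" by simp
  then have "\<mu> \<le> (ln (1 / \<delta>) + real n * l\<^sup>2) / l" using l by (simp add: field_simps)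
  also have "\<dots> = ln (1 / \<delta>) / l + real n * l" using l by (simp add: field_simps power2_eq_square)
  finally show ?thesis by (simp add: \<mu>_def)
qed

lemma expectation_signed_sum:
  assumes "over_cube n M"
  shows "measure_pmf.expectation M signed_sum = (\<Sum>i<n. 2 * expect (\<lambda>x. x ! i) M - 1)"
proof -
  have "measure_pmf.expectation M signed_sum = (\<Sum>z\<in>cube n. \<Sum>i<n. 2 * (pmf M z * of_bool (z ! i)) - pmf M z)"
    unfolding expectation_cube[OF assms]
    by (intro sum.cong refl) (auto simp: signed_sum_def cube_def sum_distrib_left algebra_simps)
  also have "\<dots> = (\<Sum>i<n. \<Sum>z\<in>cube n. 2 * (pmf M z * of_bool (z ! i)) - pmf M z)"
    by (rule sum.swap)
  also have "\<dots> = (\<Sum>i<n. 2 * expect (\<lambda>x. x ! i) M - 1)"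
    using expectation_cube[OF assms, of "\<lambda>_. 1"]
    by (intro sum.cong refl)
       (simp add: expect_def expectation_cube[OF assms] sum_subtractf sum_distrib_left[symmetric])
  finally show ?thesis .
qed

text \<open>An error \<epsilon> in probability is 2 \<epsilon> in the bias, so a model keeps bias at
  least 2 \<epsilon> in every coordinate. This is confronted with \<open>dense_signed_sum\<close> at
  l = \<epsilon>, the scale that balances its two terms for such n.\<close>

lemma biased_no_dense_model:
  assumes \<epsilon>: "0 < \<epsilon>" "4 * \<epsilon> \<le> 1" and \<delta>: "0 < \<delta>" and n: "0 < n" "2 * ln (1 / \<delta>) / \<epsilon>\<^sup>2 \<le> real n"
  shows "\<not> has_dense_model n (circuit_class n S d) \<delta> \<epsilon> (biased n (4 * \<epsilon>))"
proof
  assume "has_dense_model n (circuit_class n S d) \<delta> \<epsilon> (biased n (4 * \<epsilon>))"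
  then obtain M where M: "over_cube n M" "dense_in \<delta> M (uniform n)"
    "\<And>f. f \<in> circuit_class n S d \<Longrightarrow> \<bar>expect f (biased n (4 * \<epsilon>)) - expect f M\<bar> \<le> \<epsilon>"
    by (auto simp: has_dense_model_def)
  have "2 * \<epsilon> \<le> 2 * expect (\<lambda>x. x ! i) M - 1" if "i < n" for i
  proof -
    have "\<bar>(1 + 4 * \<epsilon>) / 2 - expect (\<lambda>x. x ! i) M\<bar> \<le> \<epsilon>"
      using M(3)[OF coordinate_in_class[OF that]] \<epsilon> that by (simp add: expect_coordinate_biased)
    then show ?thesis by (simp add: field_simps abs_le_iff)
  qed
  then have "(\<Sum>i<n. 2 * \<epsilon>) \<le> (\<Sum>i<n. 2 * expect (\<lambda>x. x ! i) M - 1)"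
    by (intro sum_mono) auto
  also have "\<dots> \<le> ln (1 / \<delta>) / \<epsilon> + real n * \<epsilon>"
    using dense_signed_sum[OF M(1,2) \<delta> \<epsilon>(1)] \<epsilon> by (simp add: expectation_signed_sum[OF M(1)])
  finally have "real n * \<epsilon> \<le> ln (1 / \<delta>) / \<epsilon>" by (simp add: algebra_simps)
  moreover have "ln (1 / \<delta>) / \<epsilon> \<le> real n * \<epsilon> / 2"
    using n(2) \<epsilon> by (simp add: field_simps power2_eq_square)
  moreover have "0 < real n * \<epsilon>" using n \<epsilon> by simp
  ultimately show False by simp
qed

section \<open>Bounded-depth circuits on biased bits\<close>

lemma expect_biased_expansion:
  assumes "f \<in> circuit_class n S d" "S \<ge> 2" "d \<ge> 2"
  shows "\<exists>b. \<forall>\<gamma>. slope_bound S d * \<bar>\<gamma>\<bar> \<le> 1 \<longrightarrow>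
    \<bar>expect f (biased n \<gamma>) - expect f (uniform n) - b * \<gamma>\<bar> \<le> (slope_bound S d * \<gamma>)\<^sup>2"
proof -
  let ?B = "slope_bound S d"
  have B: "?B \<ge> 1" by (rule slope_bound_ge_1[OF assms(2)])
  obtain b where b: "\<And>\<theta>. \<bar>\<theta>\<bar> \<le> 1 / ?B \<Longrightarrow> \<bar>bex \<theta> [0..<n] (\<lambda>x. of_bool (f (map x [0..<n])))
      - bex 0 [0..<n] (\<lambda>x. of_bool (f (map x [0..<n]))) - b * \<theta>\<bar> \<le> ?B\<^sup>2 * \<theta>\<^sup>2"
    using circuit_taylor2[OF assms] unfolding taylor2_def by auto
  have "\<bar>expect f (biased n \<gamma>) - expect f (uniform n) - b * \<gamma>\<bar> \<le> (?B * \<gamma>)\<^sup>2"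
    if "?B * \<bar>\<gamma>\<bar> \<le> 1" for \<gamma>
  proof -
    have \<gamma>: "\<bar>\<gamma>\<bar> \<le> 1 / ?B" using that B by (simp add: field_simps)
    also have "1 / ?B \<le> 1" using B by simp
    finally show ?thesis
      using b[OF \<gamma>] by (simp add: uniform_eq_biased expect_biased power_mult_distrib)
  qed
  then show ?thesis by blast
qed

lemma expect_bounds: "0 \<le> expect f X" "expect f X \<le> 1"
  by (auto simp: expect_def intro!: integral_nonneg_AE measure_pmf.integral_le_const
      measure_pmf.integrable_const_bound[where B = 1])

text \<open>The linear term is not cancelled but bounded: a slope of at most 2 B gives total error
  at most 3 B \<gamma>.\<close>

lemma biased_pseudorandom:
  assumes "S \<ge> 2" "d \<ge> 2" "0 \<le> \<gamma>" "slope_bound S d * \<gamma> \<le> 1" "3 * (slope_bound S d * \<gamma>) \<le> \<epsilon>'"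
  shows "pseudorandom n (circuit_class n S d) \<epsilon>' (biased n \<gamma>)"
  unfolding pseudorandom_def
proof (intro conjI ballI over_cube_biased)
  fix f assume f: "f \<in> circuit_class n S d"
  let ?B = "slope_bound S d"
  have B: "?B \<ge> 1" by (rule slope_bound_ge_1[OF assms(1)])
  obtain b where b: "\<And>\<gamma>. ?B * \<bar>\<gamma>\<bar> \<le> 1 \<Longrightarrow>
    \<bar>expect f (biased n \<gamma>) - expect f (uniform n) - b * \<gamma>\<bar> \<le> (?B * \<gamma>)\<^sup>2"
    using expect_biased_expansion[OF f assms(1,2)] by blast
  \<comment> \<open>At \<open>\<gamma> = 1/B\<close> the expansion bounds the slope, since expectations lie in \<open>[0, 1]\<close>.\<close>
  have "\<bar>expect f (biased n (1 / ?B)) - expect f (uniform n) - b * (1 / ?B)\<bar> \<le> 1"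
    using b[of "1 / ?B"] B by simp
  then have "\<bar>b * (1 / ?B)\<bar> \<le> 2"
    using expect_bounds[of f "biased n (1 / ?B)"] expect_bounds[of f "uniform n"] by linarith
  then have bb: "\<bar>b\<bar> \<le> 2 * ?B" using B by (simp add: abs_mult field_simps)
  have "(?B * \<gamma>)\<^sup>2 \<le> ?B * \<gamma>"
    using assms(3,4) B by (simp add: power2_eq_square mult_left_le)
  moreover have "\<bar>b * \<gamma>\<bar> \<le> 2 * ?B * \<gamma>"
    using assms(3) bb by (simp add: abs_mult mult_right_mono)
  ultimately show "\<bar>expect f (biased n \<gamma>) - expect f (uniform n)\<bar> \<le> \<epsilon>'"
    using b[of \<gamma>] assms(3-5) by (simp add: abs_le_iff)
qed

text \<open>Mixing opposite biases in inverse proportion to the weights cancels the first-order term.\<close>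

lemma mixture_pseudorandom:
  assumes "S \<ge> 2" "d \<ge> 2" "0 \<le> \<gamma>" and r: "1 / 2 \<le> r" "r < 1"
    and B\<gamma>: "slope_bound S d * \<gamma> \<le> 1 - r" and \<epsilon>': "(slope_bound S d * \<gamma>)\<^sup>2 \<le> \<epsilon>' * (1 - r)"
  shows "pseudorandom n (circuit_class n S d) \<epsilon>' (mixture r (biased n \<gamma>) (biased n (- (\<gamma> * r / (1 - r)))))"
  unfolding pseudorandom_def
proof (intro conjI ballI over_cube_mixture over_cube_biased)
  fix f assume f: "f \<in> circuit_class n S d"
  let ?B = "slope_bound S d" and ?\<gamma> = "\<gamma> * r / (1 - r)"
  have B: "?B \<ge> 1" by (rule slope_bound_ge_1[OF assms(1)])
  obtain b where b: "\<And>\<gamma>. ?B * \<bar>\<gamma>\<bar> \<le> 1 \<Longrightarrow>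
    \<bar>expect f (biased n \<gamma>) - expect f (uniform n) - b * \<gamma>\<bar> \<le> (?B * \<gamma>)\<^sup>2"
    using expect_biased_expansion[OF f assms(1,2)] by blast
  let ?R1 = "expect f (biased n \<gamma>) - expect f (uniform n) - b * \<gamma>"
  let ?R2 = "expect f (biased n (- ?\<gamma>)) - expect f (uniform n) - b * (- ?\<gamma>)"
  have R1: "\<bar>?R1\<bar> \<le> (?B * \<gamma>)\<^sup>2" using b[of \<gamma>] B\<gamma> r assms(3) by simp
  \<comment> \<open>The condition B \<gamma> <= 1 - r keeps the larger opposite bias within the
    radius 1 / B of the expansion.\<close>
  have "?B * \<gamma> * r \<le> (1 - r) * 1" using B\<gamma> r assms(3) B by (intro mult_mono) auto
  then have "?B * ?\<gamma> \<le> 1" using r by (simp add: field_simps)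
  then have R2: "\<bar>?R2\<bar> \<le> (?B * ?\<gamma>)\<^sup>2" using b[of "- ?\<gamma>"] r assms(3) by simp
  have "expect f (mixture r (biased n \<gamma>) (biased n (- ?\<gamma>))) - expect f (uniform n) = r * ?R1 + (1 - r) * ?R2"
  proof -
    have "expect f (mixture r (biased n \<gamma>) (biased n (- ?\<gamma>))) =
        r * expect f (biased n \<gamma>) + (1 - r) * expect f (biased n (- ?\<gamma>))"
      using r by (intro expect_mixture[OF over_cube_biased over_cube_biased]) auto
    moreover have "(1 - r) * (b * (- ?\<gamma>)) = - (r * (b * \<gamma>))" using r by simp
    ultimately show ?thesis by (simp only: right_diff_distrib) (simp add: left_diff_distrib)
  qed
  also have "\<bar>\<dots>\<bar> \<le> r * \<bar>?R1\<bar> + (1 - r) * \<bar>?R2\<bar>"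
    using r abs_triangle_ineq[of "r * ?R1" "(1 - r) * ?R2"] by (simp add: abs_mult)
  also have "\<dots> \<le> r * (?B * \<gamma>)\<^sup>2 + (1 - r) * (?B * ?\<gamma>)\<^sup>2"
    using r by (intro add_mono mult_left_mono R1 R2) auto
  also have "\<dots> = r * ((?B * \<gamma>)\<^sup>2 / (1 - r))"
  proof -
    have "1 - r \<noteq> 0" using r by simp
    then have "(1 - r) * (?B * ?\<gamma>)\<^sup>2 = (?B * \<gamma>)\<^sup>2 * r\<^sup>2 / (1 - r)"
      by (simp add: power_mult_distrib power_divide power2_eq_square)
    moreover have "r * x + x * r\<^sup>2 / (1 - r) = r * (x / (1 - r))" for x
      using \<open>1 - r \<noteq> 0\<close> by (simp add: field_simps power2_eq_square)
    ultimately show ?thesis by simp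
  qed
  also have "\<dots> \<le> 1 * ((?B * \<gamma>)\<^sup>2 / (1 - r))"
    using r by (intro mult_right_mono) auto
  also have "\<dots> \<le> \<epsilon>'" using \<epsilon>' r by (simp add: field_simps)
  finally show "\<bar>expect f (mixture r (biased n \<gamma>) (biased n (- ?\<gamma>))) - expect f (uniform n)\<bar> \<le> \<epsilon>'" .
qed

section \<open>Parameter estimates\<close>

lemma slope_bound_hypothesis:
  assumes S: "S \<ge> 2" and d: "d \<ge> 2" and K: "0 < K"
    and le: "real S \<le> exp (1 / (24 * 61440) * K powr (1 / (real d - 1)))"
  shows "24 * slope_bound S d \<le> K"
proof -
  define m where "m = d - 1"
  have m: "real d - 1 = real m" "m \<ge> 1" using d by (auto simp: m_def of_nat_diff)
  have "ln (real S) \<le> 1 / (24 * 61440) * K powr (1 / real m)"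
    using le S m ln_le_cancel_iff[of "real S" "exp (1 / (24 * 61440) * K powr (1 / (real d - 1)))"] by simp
  \<comment> \<open>The constant 1 / (24 * 61440) is chosen for this line: 61440 is the base of
    \<open>slope_bound\<close>, and 24 remains as slack.\<close>
  then have "24 * (61440 * ln (real S)) \<le> K powr (1 / real m)" by simp
  then have "(24 * (61440 * ln (real S))) ^ m \<le> (K powr (1 / real m)) ^ m"
    using S by (intro power_mono) auto
  also have "\<dots> = K"
    using K m by (simp add: powr_realpow[symmetric] powr_powr)
  finally have "24 ^ m * slope_bound S d \<le> K"
    by (simp only: slope_bound_def m_def power_mult_distrib)
  moreover have "24 * slope_bound S d \<le> 24 ^ m * slope_bound S d"
    using slope_bound_ge_1[OF S, of d] m(2) power_increasing[of 1 m "24::real"]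
    by (intro mult_right_mono) auto
  ultimately show ?thesis by linarith
qed

text \<open>The lower bound on \<delta> costs log 8 = 3, and \<epsilon>' <= 1/2 makes log (1 /
  \<epsilon>') at least 1, so 3 + log (1 / \<epsilon>') is at most four times that
  logarithm.\<close>

lemma log_inverse_density_le:
  assumes "0 < \<epsilon>'" "\<epsilon>' \<le> 1 / 2" "\<epsilon>' / 8 \<le> \<delta>"
  shows "log 2 (1 / \<delta>) \<le> 4 * log 2 (1 / \<epsilon>')" and "1 \<le> log 2 (1 / \<epsilon>')"
proof -
  show l: "1 \<le> log 2 (1 / \<epsilon>')"
    using assms by (simp add: le_log_iff field_simps)
  have "1 / \<delta> \<le> 8 * (1 / \<epsilon>')" using assms by (simp add: field_simps)
  moreover have "0 < \<delta>" using assms by linarith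
  ultimately have "log 2 (1 / \<delta>) \<le> log 2 (8 * (1 / \<epsilon>'))" using assms by simp
  also have "\<dots> = log 2 8 + log 2 (1 / \<epsilon>')" using assms by (intro log_mult_pos) auto
  also have "log 2 (8::real) = 3" using log_pow_cancel[of 2 3] by simp
  finally show "log 2 (1 / \<delta>) \<le> 4 * log 2 (1 / \<epsilon>')" using l by linarith
qed

text \<open>For \<delta> near 1 the compensating part of the mixture has weight at most 1 -
  \<delta>; this turns the logarithm in the hypothesis into that weight.\<close>

lemma log_inverse_near_one:
  assumes "1 / 2 \<le> \<delta>" "\<delta> < 1"
  shows "log 2 (1 / \<delta>) \<le> 3 * (1 - \<delta>)"
proof -
  have "ln (1 / \<delta>) \<le> 1 / \<delta> - 1" using assms by (intro ln_le_minus_one) auto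
  also have "\<dots> \<le> 2 * (1 - \<delta>)"
  proof -
    have "(1 - \<delta>) * 1 \<le> (1 - \<delta>) * (2 * \<delta>)" using assms by (intro mult_left_mono) auto
    then show ?thesis using assms by (simp add: field_simps)
  qed
  finally have "ln (1 / \<delta>) \<le> 2 * (1 - \<delta>)" .
  moreover have "2 * (1 - \<delta>) = (2 / 3) * (3 * (1 - \<delta>))" by simp
  moreover have "(2 / 3) * (3 * (1 - \<delta>)) \<le> ln 2 * (3 * (1 - \<delta>))"
    using ln2_ge_two_thirds assms by (intro mult_right_mono) auto
  ultimately have "ln (1 / \<delta>) \<le> ln 2 * (3 * (1 - \<delta>))" by linarith
  then show ?thesis unfolding log_def by (simp add: field_simps)
qed

text \<open>Density wants r >= \<delta>, whereas pseudorandomness wants 1 - r large: hence r = 1/2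
  for \<delta> <= 1/2 and r = \<delta> in the remaining mixture case. The constant 576 is
  24^2.\<close>

lemma dense_in_pseudorandom:
  assumes \<epsilon>: "0 < \<epsilon>" and \<epsilon>': "0 < \<epsilon>'" "\<epsilon>' \<le> 1 / 2" and \<delta>: "0 < \<delta>" "\<delta> < 1" "\<epsilon>' / 8 \<le> \<delta>"
    and d: "d \<ge> 2" and S: "S \<ge> 2"
    and Q: "576 * (slope_bound S d * \<epsilon>)\<^sup>2 \<le> \<epsilon>' * log 2 (1 / \<delta>) / (log 2 (1 / \<epsilon>'))\<^sup>2"
  shows "\<exists>X. pseudorandom n (circuit_class n S d) \<epsilon>' X \<and> dense_in \<delta> (biased n (4 * \<epsilon>)) X"
proof -
  define l where "l = log 2 (1 / \<epsilon>')"
  define q where "q = slope_bound S d * \<epsilon>"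
  have q: "0 \<le> q" using slope_bound_ge_1[OF S, of d] \<epsilon> by (simp add: q_def)
  have sq: "(4 * q)\<^sup>2 = 16 * q\<^sup>2" "(12 * q)\<^sup>2 = 144 * q\<^sup>2"
    by (simp_all add: power_mult_distrib)
  have q4: "slope_bound S d * (4 * \<epsilon>) = 4 * q" by (simp add: q_def)
  have l: "1 \<le> l" "log 2 (1 / \<delta>) \<le> 4 * l"
    using log_inverse_density_le[OF \<epsilon>' \<delta>(3)] by (auto simp: l_def)
  have l2: "l \<le> l\<^sup>2" "1 \<le> l\<^sup>2" using l self_le_power[of l 2] one_le_power[of l 2] by auto
  have L: "0 < log 2 (1 / \<delta>)" using \<delta> by simp
  have mix: "\<exists>X. pseudorandom n (circuit_class n S d) \<epsilon>' X \<and> dense_in \<delta> (biased n (4 * \<epsilon>)) X"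
    if r: "1 / 2 \<le> r" "r < 1" "\<delta> \<le> r" and B: "4 * q \<le> 1 - r" "(4 * q)\<^sup>2 \<le> \<epsilon>' * (1 - r)" for r
  proof (intro exI conjI)
    let ?X = "mixture r (biased n (4 * \<epsilon>)) (biased n (- (4 * \<epsilon> * r / (1 - r))))"
    show "pseudorandom n (circuit_class n S d) \<epsilon>' ?X"
      using \<epsilon> r B by (intro mixture_pseudorandom S d) (auto simp: q4)
    have "\<delta> * pmf (biased n (4 * \<epsilon>)) z \<le> r * pmf (biased n (4 * \<epsilon>)) z" for z
      using r by (intro mult_right_mono) auto
    moreover have "r * pmf (biased n (4 * \<epsilon>)) z \<le> pmf ?X z" for z
      using r by (simp add: pmf_mixture)
    ultimately show "dense_in \<delta> (biased n (4 * \<epsilon>)) ?X"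
      unfolding dense_in_def using order.trans by blast
  qed
  show ?thesis
  proof (cases "\<delta> \<le> 1 / 2")
    case True
    have "log 2 (1 / \<delta>) \<le> 4 * l\<^sup>2" using l(2) l2 by linarith
    then have "log 2 (1 / \<delta>) / l\<^sup>2 \<le> 4" using l(1) by (subst pos_divide_le_eq) auto
    then have "\<epsilon>' * (log 2 (1 / \<delta>) / l\<^sup>2) \<le> \<epsilon>' * 4" using \<epsilon>' by (intro mult_left_mono) auto
    then have Q: "576 * q\<^sup>2 \<le> 4 * \<epsilon>'" using Q by (simp add: l_def q_def)
    then have "(4 * q)\<^sup>2 \<le> (1 / 2)\<^sup>2" using \<epsilon>' by (simp add: power_mult_distrib power2_eq_square)
    then have "4 * q \<le> 1 / 2" by (rule power2_le_imp_le) simp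
    then show ?thesis
      using Q True \<epsilon>' by (intro mix[of "1 / 2"]) (auto simp: power_mult_distrib)
  next
    case False
    define \<eta> where "\<eta> = 1 - \<delta>"
    have \<eta>: "0 < \<eta>" "\<eta> < 1" using \<delta> by (auto simp: \<eta>_def)
    have L3: "log 2 (1 / \<delta>) \<le> 3 * \<eta>" unfolding \<eta>_def using False \<delta> by (intro log_inverse_near_one) auto
    have "\<epsilon>' * log 2 (1 / \<delta>) / l\<^sup>2 \<le> \<epsilon>' * log 2 (1 / \<delta>) / 1"
      using l2 \<epsilon>' L by (intro divide_left_mono) auto
    also have "\<dots> \<le> \<epsilon>' * (3 * \<eta>)" using L3 \<epsilon>' by simp
    finally have Q: "576 * q\<^sup>2 \<le> 3 * (\<epsilon>' * \<eta>)" using Q by (simp add: l_def q_def)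
    \<comment> \<open>The mixture needs 4 q <= \<eta>, but only q^2 of order at most \<epsilon>'
      \<eta> is known. For \<eta> <= \<epsilon>' that may be too weak; then, however, 12 q <=
      \<epsilon>', and even the uncancelled linear error is small enough.\<close>
    show ?thesis
    proof (cases "\<eta> \<le> \<epsilon>'")
      case True
      then have "\<epsilon>' * \<eta> \<le> \<epsilon>'\<^sup>2" using \<epsilon>' by (simp add: power2_eq_square)
      then have "(12 * q)\<^sup>2 \<le> \<epsilon>'\<^sup>2" using Q zero_le_power2[of q] unfolding sq by linarith
      then have "12 * q \<le> \<epsilon>'" by (rule power2_le_imp_le) (use \<epsilon>' in simp)
      then have "pseudorandom n (circuit_class n S d) \<epsilon>' (biased n (4 * \<epsilon>))"
        using \<epsilon> \<epsilon>' by (intro biased_pseudorandom S d) (auto simp: q4)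
      moreover have "dense_in \<delta> (biased n (4 * \<epsilon>)) (biased n (4 * \<epsilon>))"
        using \<delta> by (auto simp: dense_in_def mult_left_le_one_le)
      ultimately show ?thesis by blast
    next
      case F2: False
      have pos: "0 < \<epsilon>' * \<eta>" using \<epsilon>' \<eta> by simp
      have "\<epsilon>' * \<eta> \<le> \<eta>\<^sup>2" using F2 \<eta> by (simp add: power2_eq_square)
      then have "(4 * q)\<^sup>2 \<le> \<eta>\<^sup>2" using Q pos zero_le_power2[of q] unfolding sq by linarith
      then have "4 * q \<le> \<eta>" by (rule power2_le_imp_le) (use \<eta> in simp)
      moreover have "(4 * q)\<^sup>2 \<le> \<epsilon>' * \<eta>" using Q pos zero_le_power2[of q] unfolding sq by linarith
      ultimately show ?thesis using False \<delta> by (intro mix[of \<delta>]) (auto simp: \<eta>_def)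
    qed
  qed
qed

text \<open>The ranges of \<epsilon>' and S give log (1 / \<epsilon>') >= 1 and B >= 1, on which the
  closing inequalities between \<epsilon>, \<delta> and n rest.\<close>

theorem theorem1p4:
  "\<exists>c\<^sub>0 C :: real. c\<^sub>0 > 0 \<and> C > 0 \<and>
     (\<forall>(\<epsilon> :: real) (\<epsilon>' :: real) (\<delta> :: real) (d :: nat) (S :: nat).
        \<epsilon> > 0 \<longrightarrow> 0 < \<epsilon>' \<longrightarrow> \<epsilon>' \<le> 1 / 2 \<longrightarrow> 0 < \<delta> \<longrightarrow> \<delta> < 1 \<longrightarrow> \<delta> \<ge> \<epsilon>' / 8 \<longrightarrow>
        d \<ge> 2 \<longrightarrow> S \<ge> 2 \<longrightarrow>
        real S \<le> exp (c\<^sub>0 * ((sqrt \<epsilon>' / \<epsilon>) * (sqrt (log 2 (1 / \<delta>)) / log 2 (1 / \<epsilon>')))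
                             powr (1 / (real d - 1))) \<longrightarrow>
        (\<exists>n :: nat. real n \<le> C * log 2 (1 / \<delta>) / \<epsilon>\<^sup>2 \<and>
          (\<exists>D. over_cube n D \<and>
               (\<exists>X. pseudorandom n (circuit_class n S d) \<epsilon>' X \<and> dense_in \<delta> D X) \<and>
               \<not> has_dense_model n (circuit_class n S d) \<delta> \<epsilon> D)))"
proof (rule exI[of _ "1 / (24 * 61440)"], rule exI[of _ 3], intro conjI allI impI)
  fix \<epsilon> \<epsilon>' \<delta> :: real and d S :: nat
  assume \<epsilon>: "\<epsilon> > 0" and \<epsilon>': "0 < \<epsilon>'" "\<epsilon>' \<le> 1 / 2" and \<delta>: "0 < \<delta>" "\<delta> < 1" "\<epsilon>' / 8 \<le> \<delta>"
    and d: "d \<ge> 2" and S: "S \<ge> 2"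
    and le: "real S \<le> exp (1 / (24 * 61440) * ((sqrt \<epsilon>' / \<epsilon>) * (sqrt (log 2 (1 / \<delta>)) / log 2 (1 / \<epsilon>')))
                             powr (1 / (real d - 1)))"
  define L where "L = log 2 (1 / \<delta>)"
  define l where "l = log 2 (1 / \<epsilon>')"
  let ?B = "slope_bound S d"
  have L: "0 < L" using \<delta> by (simp add: L_def)
  have l: "1 \<le> l" "L \<le> 4 * l" using log_inverse_density_le[OF \<epsilon>' \<delta>(3)] by (auto simp: l_def L_def)
  have B: "?B \<ge> 1" by (rule slope_bound_ge_1[OF S])
  have "24 * ?B \<le> (sqrt \<epsilon>' / \<epsilon>) * (sqrt L / l)"
    using le L l \<epsilon> \<epsilon>' unfolding L_def[symmetric] l_def[symmetric]
    by (intro slope_bound_hypothesis S d) auto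
  then have "24 * (?B * \<epsilon>) \<le> sqrt \<epsilon>' * sqrt L / l" using \<epsilon> l by (simp add: field_simps)
  then have "(24 * (?B * \<epsilon>))\<^sup>2 \<le> (sqrt \<epsilon>' * sqrt L / l)\<^sup>2"
    using B \<epsilon> by (intro power_mono) auto
  then have Q: "576 * (?B * \<epsilon>)\<^sup>2 \<le> \<epsilon>' * L / l\<^sup>2"
    using \<epsilon>' L by (simp add: power_mult_distrib power_divide)
  have "1 * \<epsilon>\<^sup>2 \<le> ?B\<^sup>2 * \<epsilon>\<^sup>2" using B by (intro mult_right_mono) auto
  then have Q': "576 * \<epsilon>\<^sup>2 \<le> \<epsilon>' * L / l\<^sup>2" using Q by (simp add: power_mult_distrib)
  have l2: "1 \<le> l\<^sup>2" "l \<le> l\<^sup>2" using l self_le_power[of l 2] one_le_power[of l 2] by auto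
  have "\<epsilon>' * L / l\<^sup>2 \<le> \<epsilon>' * L / 1" using l2 \<epsilon>' L by (intro divide_left_mono) auto
  also have "\<dots> \<le> 1 * L" using \<epsilon>' L by simp
  finally have \<epsilon>L: "\<epsilon>\<^sup>2 \<le> L" using Q' zero_le_power2[of \<epsilon>] by linarith
  \<comment> \<open>What remains is 576 \<epsilon>^2 <= 2, enough for 4 \<epsilon> to be a
    bias.\<close>
  have "L / l\<^sup>2 \<le> 4" using l l2 by (subst pos_divide_le_eq) auto
  then have "\<epsilon>' * (L / l\<^sup>2) \<le> 1 / 2 * 4" using \<epsilon>' L by (intro mult_mono) auto
  then have "(4 * \<epsilon>)\<^sup>2 \<le> 1\<^sup>2" using Q' by (simp add: power_mult_distrib)
  then have \<epsilon>4: "4 * \<epsilon> \<le> 1" by (rule power2_le_imp_le) simp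
  define n where "n = nat \<lceil>2 * L / \<epsilon>\<^sup>2\<rceil>"
  \<comment> \<open>This absorbs the rounding up of 2 L / \<epsilon>^2 and explains C = 3.\<close>
  have Le: "1 \<le> L / \<epsilon>\<^sup>2" using \<epsilon>L \<epsilon> by simp
  have n: "2 * L / \<epsilon>\<^sup>2 \<le> real n" "real n \<le> 2 * L / \<epsilon>\<^sup>2 + 1"
    using L \<epsilon> of_int_ceiling_le_add_one[of "2 * L / \<epsilon>\<^sup>2"] by (simp_all add: n_def)
  have n3: "real n \<le> 3 * L / \<epsilon>\<^sup>2" using n(2) Le by (simp only: times_divide_eq_right[symmetric])
  have n0: "0 < n" using n(1) Le by (cases n) auto
  have "ln (1 / \<delta>) \<le> L"
  proof -
    have "ln (1 / \<delta>) = L * ln 2" by (simp add: L_def log_def)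
    also have "\<dots> \<le> L * 1" using L ln_2_less_1 by (intro mult_left_mono) auto
    finally show ?thesis by simp
  qed
  then have "2 * ln (1 / \<delta>) / \<epsilon>\<^sup>2 \<le> 2 * L / \<epsilon>\<^sup>2" by (intro divide_right_mono) auto
  with n(1) have n2: "2 * ln (1 / \<delta>) / \<epsilon>\<^sup>2 \<le> real n" by linarith
  show "\<exists>n :: nat. real n \<le> 3 * log 2 (1 / \<delta>) / \<epsilon>\<^sup>2 \<and>
          (\<exists>D. over_cube n D \<and>
               (\<exists>X. pseudorandom n (circuit_class n S d) \<epsilon>' X \<and> dense_in \<delta> D X) \<and>
               \<not> has_dense_model n (circuit_class n S d) \<delta> \<epsilon> D)"
    using n3 over_cube_biased biased_no_dense_model[OF \<epsilon> \<epsilon>4 \<delta>(1) n0 n2]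
      dense_in_pseudorandom[OF \<epsilon> \<epsilon>' \<delta> d S Q[unfolded L_def l_def]]
    unfolding L_def by blast
qed auto

end
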